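(* Let $X$ be a $\mathrm D$-valued random element such that for some $t_0\in\mathcal Q$ and $\alpha>0$ we have $\|X\|_{t_0}\in\mathcal R_\alpha$, i.e. $\lim_{z\to\infty}\mathbb P\{\|X\|_{t_0}>zt\}/\mathbb P\{\|X\|_{t_0}>z\}=t^{-\alpha}$ for all $t>0$, and such that for some constants $p_h\in[0,\infty)$, $h\in\mathcal Q$, with $p_{t_0}\in(0,\infty)$, $$\lim_{z\to\infty}\frac{\mathbb P\{\|X\|_h>z\}}{\mathbb P\{\|X\|_{t_0}>z\}}=\frac{p_h}{p_{t_0}},\qquad\forall h\in\mathcal Q.$$ Assume that for all $h\in\mathcal Q$ with $p_h>0$, conditionally on $\|X\|_h>z$, $z^{-1}\bullet X$ converges weakly on $(\mathrm D,d_{\mathrm D})$ to $Y^{[h]}$ as $z\to\infty$. Suppose further that $$\limsup_{z\to\infty}\frac{\mathbb P\{X_K^*>\varepsilon z\}}{\mathbb P\{\|X\|_{t_0}>z\}}<\infty,\qquad\forall\varepsilon>0,\ \forall K\in K(\mathcal Q),$$ and that for some $c>1$ and some positive constants $q_t$, $t\in\mathcal Q$, with $\sum_{t\in\mathcal Q}\max(1,p_t)q_t<\infty$, $$\lim_{\eta\downarrow0}\limsup_{z\to\infty}\frac{\mathbb P\{X_K^*>c\varepsilon z,\ \mathcal E_K^q((\varepsilon z)^{-1}\bullet X)\le\eta\}}{\mathbb P\{\|X\|_{t_0}>z\}}=0,\qquad\forall\varepsilon>0,\ \forall K\in K(\mathcal Q).$$ If $Y^{[h]}$, $h\in\mathcal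 Q$, is a family of tail processes with index $\alpha$ and weights $p_h$, if $\mathcal E^q_K(\cdot)$ is almost surely continuous with respect to the law of $Y^{[h]}$ for all $h\in\mathcal Q$, and if the boundedness $\mathcal B$ has the property that $A\in\mathcal B$ if and only if there exist an index set $K_A\subset\mathcal T$ and $\varepsilon_A>0$ such that $f^*_{K_A}>\varepsilon_A$ for all $f\in A$, then there exists a $\mathcal B$-boundedly finite Borel tail measure $\nu$ on $\mathrm D$ with index $\alpha$ such that $\nu(\{f\in\mathrm D:f^*_K>1\})<\infty$ for all $K\in K(\mathcal Q)$, and $X$ is regularly varying with respect to $\mathcal B$ with limit measure $\nu$ and scaling function $g(t)=p_{t_0}/\mathbb P\{\|X\|_{t_0}>t\}$, i.e. $g(z)\mathbb P\{X\in z\bullet\cdot\}$ converges $\mathcal B$-vaguely to $\nu$ as $z\to\infty$.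
   Context: Setting. $(\mathrm D,d_{\mathrm D})$ is a Polish metric space with Borel $\sigma$-field $\mathscr D$, equipped with a pairing $(z,f)\mapsto z\bullet f\in\mathrm D$, $z\in(0,\infty)$, with $1\bullet f=f$, $(z_1z_2)\bullet f=z_1\bullet(z_2\bullet f)$, jointly measurable. $\mathcal Q=\{t_i,i\in\mathbb N\}$ is a non-empty countable subset of a parameter space $\mathcal T$; for every $t\in\mathcal Q$, $\|\cdot\|_t:\mathrm D\to[0,\infty)$ is Borel measurable, $\|z\bullet f\|_t=z\|f\|_t$, and $\|f\|_t\in(0,\infty)$ for some $f$. For $K\subset\mathcal T$, $f_K^*=\sup_{t\in K\cap\mathcal Q}\|f\|_t$ (equal to $0$ if $K\cap\mathcal Q=\emptyset$). $K(\mathcal Q)=\{K_n\subset\mathcal Q,n\in\mathbb N\}$ is a given family with $\bigcup_nK_n=\mathcal Q$. Random elements are defined on a complete probability space. For positive constants $q_t$ put $\mathcal E_K^q(f)=\sum_{t\in K}\mathbf 1(\|f\|_t>1)q_t$, $K\subset\mathcal Q$. Boundedness. $\mathcal B$ is a properly localised boundedness on $\mathrm D$: a non-empty class of subsets of $\mathrm D$ closed under finite unions and under taking subsets, for which there are open sets $O_n\in\mathcal B$, $n\in\mathbb N$, with $\overline{O_n}\subset O_{n+1}$, $\bigcup_nO_n=\mathrm D$, and every $A\in\mathcal B$ is contained in some $O_n$. Moreover $z\bullet A\in\mathcal B$ for all $A\in\mathcal B$, $z>0$. A Borel measure $\nu$ is $\mathcal B$-boundedly finite if $\nu(A)<\infty$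 for all Borel $A\in\mathcal B$. $\mathcal B$-boundedly finite measures $\nu_z$ converge $\mathcal B$-vaguely to $\nu$ if $\int H\,d\nu_z\to\int H\,d\nu$ for all bounded continuous $H:\mathrm D\to\mathbb R$ whose support belongs to $\mathcal B$. Tail measure. A measure $\nu$ on $\mathscr D$ is a tail measure with index $\alpha>0$ if: $\nu(z\bullet A)=z^{-\alpha}\nu(A)$ for all $z>0$, $A\in\mathscr D$; $\nu(\{f:\sup_{t\in\mathcal Q}\|f\|_t=0\})=0$; and $\nu(\{f:\|f\|_h>1\})<\infty$ for all $h\in\mathcal Q$, with a positive value for some $h_0\in\mathcal Q$. Family of tail processes. $\mathrm D$-valued random elements $Y^{[h]}$, $h\in\mathcal Q$, form a family of tail processes with index $\alpha>0$ and weights $p_h\in[0,\infty)$ (with $p_{h_0}>0$ for some $h_0$) if $\mathbb P\{\|Y^{[h]}\|_h>1\}=1$ for all $h\in\mathcal Q$; for all $h,t\in\mathcal Q$ with $p_hp_t>0$, all $x>0$ and all measurable $\Gamma:\mathrm D\to[0,\infty]$ or $\Gamma:\mathrm D\to\mathbb R$ (when expectations exist), $p_h\mathbb E\{\Gamma(x\bullet Y^{[h]})\mathbf 1(x\|Y^{[h]}\|_t>1)\}=p_tx^\alpha\mathbb E\{\Gamma(Y^{[t]})\mathbf 1(\|Y^{[t]}\|_h>x)\}$; and $\mathbb P\{\|Y^{[t]}\|_h=0\}=1$ whenever $p_h=0$, $p_t>0$.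
   Formalization: The pairing f ↦ z•f is additionally assumed continuous for each fixed z>0, and in the description of B the index set K_A must have K_A∩Q contained in a finite union of members of K(Q); without either condition the statement has counterexamples. *)

theory Defs
  imports "HOL-Probability.Probability"
begin

text \<open>
  \<open>act z f\<close> is the pairing of \<open>z > 0\<close> with \<open>f\<close>, \<open>nrm t f\<close> is the value at \<open>f\<close> of the map
  indexed by \<open>t\<close>, and \<open>KQ 0, KQ 1, \<dots>\<close> enumerates the given family of subsets of \<open>Q\<close>.
  Values of \<open>act\<close> at \<open>z \<le> 0\<close> and of \<open>nrm\<close> at \<open>t \<notin> Q\<close> are unconstrained and never matter.
\<close>

locale homogeneous_setting =
  fixes act :: "real \<Rightarrow> 'd::polish_space \<Rightarrow> 'd"
    and nrm :: "'t \<Rightarrow> 'd \<Rightarrow> real"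
    and T Q :: "'t set"
    and KQ :: "nat \<Rightarrow> 't set"
  assumes act_one: "act 1 f = f"
    and act_mult: "z1 > 0 \<Longrightarrow> z2 > 0 \<Longrightarrow> act (z1 * z2) f = act z1 (act z2 f)"
    and act_measurable:
      "(\<lambda>(z, f). act z f) \<in> restrict_space borel {0<..} \<Otimes>\<^sub>M borel \<rightarrow>\<^sub>M borel"
    and Q_subset: "Q \<subseteq> T"
    and Q_countable: "countable Q"
    and Q_nonempty: "Q \<noteq> {}"
    and nrm_nonneg: "t \<in> Q \<Longrightarrow> nrm t f \<ge> 0"
    and nrm_measurable: "t \<in> Q \<Longrightarrow> nrm t \<in> borel_measurable borel"
    and nrm_homogeneous: "t \<in> Q \<Longrightarrow> z > 0 \<Longrightarrow> nrm t (act z f) = z * nrm t f"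
    and nrm_nontrivial: "t \<in> Q \<Longrightarrow> \<exists>f. nrm t f > 0"
    and KQ_subset: "KQ n \<subseteq> Q"
    and KQ_cover: "(\<Union>n. KQ n) = Q"

text \<open>
  The supremum may be infinite; in \<^typ>\<open>ennreal\<close> the supremum over the empty set is \<open>0\<close>.
\<close>

definition nrm_sup :: "('t \<Rightarrow> 'd \<Rightarrow> real) \<Rightarrow> 't set \<Rightarrow> 't set \<Rightarrow> 'd \<Rightarrow> ennreal" where
  "nrm_sup nrm Q K f = (SUP t\<in>K \<inter> Q. ennreal (nrm t f))"

definition exceedance :: "('t \<Rightarrow> 'd \<Rightarrow> real) \<Rightarrow> ('t \<Rightarrow> real) \<Rightarrow> 't set \<Rightarrow> 'd \<Rightarrow> ennreal" where
  "exceedance nrm q K f = (\<Sum>\<^sub>\<infinity>t\<in>K. ennreal (indicator {g. nrm t g > 1} f * q t))"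

definition properly_localised_boundedness :: "'d::topological_space set set \<Rightarrow> bool" where
  "properly_localised_boundedness B \<longleftrightarrow>
     B \<noteq> {} \<and>
     (\<forall>A\<in>B. \<forall>A'\<in>B. A \<union> A' \<in> B) \<and>
     (\<forall>A\<in>B. \<forall>A'. A' \<subseteq> A \<longrightarrow> A' \<in> B) \<and>
     (\<exists>U :: nat \<Rightarrow> 'd set.
        (\<forall>n. open (U n) \<and> U n \<in> B \<and> closure (U n) \<subseteq> U (Suc n)) \<and>
        (\<Union>n. U n) = UNIV \<and>
        (\<forall>A\<in>B. \<exists>n. A \<subseteq> U n))"

definition boundedly_finite :: "'d::topological_space set set \<Rightarrow> 'd measure \<Rightarrow> bool" where
  "boundedly_finite B \<nu> \<longleftrightarrow>
     sets \<nu> = sets borel \<and> (\<forall>A\<in>sets borel. A \<in> B \<longrightarrow> emeasure \<nu> A < \<infinity>)"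

definition vaguely_converges ::
  "'d::topological_space set set \<Rightarrow> ('i \<Rightarrow> 'd measure) \<Rightarrow> 'd measure \<Rightarrow> 'i filter \<Rightarrow> bool" where
  "vaguely_converges B \<mu> \<nu> F \<longleftrightarrow>
     (\<forall>\<^sub>F z in F. boundedly_finite B (\<mu> z)) \<and> boundedly_finite B \<nu> \<and>
     (\<forall>H :: 'd \<Rightarrow> real. continuous_on UNIV H \<longrightarrow> bounded (range H) \<longrightarrow>
        closure {f. H f \<noteq> 0} \<in> B \<longrightarrow>
        ((\<lambda>z. integral\<^sup>L (\<mu> z) H) \<longlongrightarrow> integral\<^sup>L \<nu> H) F)"

definition weakly_converges ::
  "('i \<Rightarrow> 'd::topological_space measure) \<Rightarrow> 'd measure \<Rightarrow> 'i filter \<Rightarrow> bool" where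
  "weakly_converges \<mu> \<nu> F \<longleftrightarrow>
     (\<forall>H :: 'd \<Rightarrow> real. continuous_on UNIV H \<longrightarrow> bounded (range H) \<longrightarrow>
        ((\<lambda>z. integral\<^sup>L (\<mu> z) H) \<longlongrightarrow> integral\<^sup>L \<nu> H) F)"

text \<open>The law of \<open>act (1/z) X\<close> conditionally on \<open>nrm h X > z\<close>.\<close>

definition conditional_scaled_law ::
  "(real \<Rightarrow> 'd::topological_space \<Rightarrow> 'd) \<Rightarrow> ('t \<Rightarrow> 'd \<Rightarrow> real) \<Rightarrow> 'w measure \<Rightarrow> ('w \<Rightarrow> 'd) \<Rightarrow>
     't \<Rightarrow> real \<Rightarrow> 'd measure" where
  "conditional_scaled_law act nrm M X h z =
     distr (uniform_measure M {\<omega>\<in>space M. nrm h (X \<omega>) > z}) borel (\<lambda>\<omega>. act (1 / z) (X \<omega>))"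

text \<open>
  The measure \<open>A \<mapsto> c * P(X \<in> act z ` A)\<close>, for \<open>z > 0\<close> and \<open>c \<ge> 0\<close>; see
  \<open>emeasure_scaled_law\<close> below.
\<close>

definition scaled_law ::
  "(real \<Rightarrow> 'd::topological_space \<Rightarrow> 'd) \<Rightarrow> 'w measure \<Rightarrow> ('w \<Rightarrow> 'd) \<Rightarrow> real \<Rightarrow> real \<Rightarrow> 'd measure" where
  "scaled_law act M X c z =
     scale_measure (ennreal c) (distr M borel (\<lambda>\<omega>. act (1 / z) (X \<omega>)))"

definition regularly_varying ::
  "(real \<Rightarrow> 'd::topological_space \<Rightarrow> 'd) \<Rightarrow> 'd set set \<Rightarrow> 'w measure \<Rightarrow> ('w \<Rightarrow> 'd) \<Rightarrow>
     'd measure \<Rightarrow> (real \<Rightarrow> real) \<Rightarrow> bool" where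
  "regularly_varying act B M X \<nu> g \<longleftrightarrow>
     vaguely_converges B (\<lambda>z. scaled_law act M X (g z) z) \<nu> at_top"

definition tail_measure ::
  "(real \<Rightarrow> 'd::topological_space \<Rightarrow> 'd) \<Rightarrow> ('t \<Rightarrow> 'd \<Rightarrow> real) \<Rightarrow> 't set \<Rightarrow> real \<Rightarrow> 'd measure \<Rightarrow> bool" where
  "tail_measure act nrm Q \<alpha> \<nu> \<longleftrightarrow>
     \<alpha> > 0 \<and>
     sets \<nu> = sets borel \<and>
     (\<forall>z>0. \<forall>A\<in>sets borel. emeasure \<nu> (act z ` A) = ennreal (z powr (-\<alpha>)) * emeasure \<nu> A) \<and>
     emeasure \<nu> {f. nrm_sup nrm Q Q f = 0} = 0 \<and>
     (\<forall>h\<in>Q. emeasure \<nu> {f. nrm h f > 1} < \<infinity>) \<and>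
     (\<exists>h0\<in>Q. emeasure \<nu> {f. nrm h0 f > 1} > 0)"

definition tail_process_family ::
  "(real \<Rightarrow> 'd::topological_space \<Rightarrow> 'd) \<Rightarrow> ('t \<Rightarrow> 'd \<Rightarrow> real) \<Rightarrow> 't set \<Rightarrow> real \<Rightarrow> ('t \<Rightarrow> real) \<Rightarrow>
     'w measure \<Rightarrow> ('t \<Rightarrow> 'w \<Rightarrow> 'd) \<Rightarrow> bool" where
  "tail_process_family act nrm Q \<alpha> p M Y \<longleftrightarrow>
     \<alpha> > 0 \<and>
     (\<forall>h\<in>Q. p h \<ge> 0) \<and> (\<exists>h0\<in>Q. p h0 > 0) \<and>
     (\<forall>h\<in>Q. Y h \<in> M \<rightarrow>\<^sub>M borel) \<and>
     (\<forall>h\<in>Q. measure M {\<omega>\<in>space M. nrm h (Y h \<omega>) > 1} = 1) \<and>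
     (\<forall>h\<in>Q. \<forall>t\<in>Q. p h * p t > 0 \<longrightarrow> (\<forall>x>0.
        (\<forall>\<Gamma> :: 'd \<Rightarrow> ennreal. \<Gamma> \<in> borel_measurable borel \<longrightarrow>
           ennreal (p h) *
             (\<integral>\<^sup>+\<omega>. \<Gamma> (act x (Y h \<omega>)) * indicator {f. x * nrm t f > 1} (Y h \<omega>) \<partial>M) =
           ennreal (p t * x powr \<alpha>) *
             (\<integral>\<^sup>+\<omega>. \<Gamma> (Y t \<omega>) * indicator {f. nrm h f > x} (Y t \<omega>) \<partial>M)) \<and>
        (\<forall>\<Gamma> :: 'd \<Rightarrow> real. \<Gamma> \<in> borel_measurable borel \<longrightarrow>
           integrable M (\<lambda>\<omega>. \<Gamma> (act x (Y h \<omega>)) * indicator {f. x * nrm t f > 1} (Y h \<omega>)) \<longrightarrow>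
           integrable M (\<lambda>\<omega>. \<Gamma> (Y t \<omega>) * indicator {f. nrm h f > x} (Y t \<omega>)) \<longrightarrow>
           p h *
             (\<integral>\<omega>. \<Gamma> (act x (Y h \<omega>)) * indicator {f. x * nrm t f > 1} (Y h \<omega>) \<partial>M) =
           p t * x powr \<alpha> *
             (\<integral>\<omega>. \<Gamma> (Y t \<omega>) * indicator {f. nrm h f > x} (Y t \<omega>) \<partial>M)))) \<and>
     (\<forall>h\<in>Q. \<forall>t\<in>Q. p h = 0 \<longrightarrow> p t > 0 \<longrightarrow> measure M {\<omega>\<in>space M. nrm h (Y t \<omega>) = 0} = 1)"

lemma (in homogeneous_setting) act_measurable_fixed:
  assumes "z > 0"
  shows "act z \<in> borel \<rightarrow>\<^sub>M borel"
proof -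
  have "(\<lambda>f. (z, f)) \<in> borel \<rightarrow>\<^sub>M restrict_space borel {0<..} \<Otimes>\<^sub>M borel"
    using assms by (intro measurable_Pair measurable_const measurable_ident) 
      (auto simp: space_restrict_space)
  from measurable_compose[OF this act_measurable] show ?thesis
    by simp
qed

lemma (in homogeneous_setting) act_image_iff:
  assumes "z > 0"
  shows "g \<in> act z ` A \<longleftrightarrow> act (1 / z) g \<in> A"
proof -
  have "act (1 / z) (act z f) = f" "act z (act (1 / z) f) = f" for f
    using assms act_one act_mult[of "1 / z" z f] act_mult[of z "1 / z" f] by auto
  then show ?thesis
    by (metis image_iff)
qed

lemma (in homogeneous_setting) emeasure_scaled_law:
  assumes "X \<in> M \<rightarrow>\<^sub>M borel" "z > 0" "A \<in> sets borel"
  shows "emeasure (scaled_law act M X c z) A =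
    ennreal c * emeasure M {\<omega>\<in>space M. X \<omega> \<in> act z ` A}"
proof -
  have meas: "(\<lambda>\<omega>. act (1 / z) (X \<omega>)) \<in> M \<rightarrow>\<^sub>M borel"
    using measurable_compose[OF assms(1) act_measurable_fixed[of "1 / z"]] assms(2) by simp
  have "(\<lambda>\<omega>. act (1 / z) (X \<omega>)) -` A \<inter> space M = {\<omega>\<in>space M. X \<omega> \<in> act z ` A}"
    using act_image_iff[OF assms(2)] by auto
  then show ?thesis
    unfolding scaled_law_def using meas assms(3) by (simp add: emeasure_distr)
qed

end

theory Submission
  imports Defs
begin

text \<open>
  The limit measure is forced. By homogeneity, a tail measure \<open>\<nu>\<close> that describes the limits
  \<open>Y h\<close> must coincide, on \<open>{f. nrm h f > r}\<close>, with \<open>p h * r powr - \<alpha>\<close> times the law of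
  \<open>act r (Y h)\<close>. The identity that defines a family of tail processes says precisely that
  these prescriptions agree wherever two of the sets overlap, so they glue to one measure
  (\<open>tail_measure_of_family\<close>); homogeneity holds because the rescaled measure satisfies the
  same prescriptions.

  For the convergence, let \<open>H\<close> be continuous and bounded, and suppose first that the supremum of
  the norms over one of finitely many sets \<open>KQ n\<close> exceeds \<open>c\<close> wherever \<open>H \<noteq> 0\<close>.
  Let \<open>W\<close>, formally \<open>exceedance_sum\<close>, be the sum over these \<open>n\<close> of the exceedance
  functionals of \<open>KQ n\<close>; it is positive where \<open>H \<noteq> 0\<close>. If \<open>1 / W\<close> were bounded, one could
  write \<open>H = (H / W) * W\<close> and expand the second factor: the expectation of \<open>H\<close> at the rescaled
  \<open>X\<close> becomes a weighted sum over \<open>t\<close> of expectations of \<open>H / W\<close> on the single events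
  \<open>nrm t X > z\<close>. Each of these converges by the conditional limit theorem for \<open>t\<close>, because \<open>W\<close>
  is almost surely continuous under the law of \<open>Y t\<close> (\<open>scaled_level_tendsto\<close>), and the sum may
  be exchanged with the limit because each term is dominated by \<open>q t\<close> times the normalised tail
  of the supremum over \<open>KQ n\<close> (\<open>scaled_exceedance_tendsto\<close>). Since \<open>1 / W\<close> is not bounded,
  \<open>W / max W \<eta>\<close> replaces \<open>1\<close>: the expansion then applies to \<open>H / max W \<eta>\<close>
  (\<open>damped_tendsto\<close>), and the error lives on the event that the supremum exceeds \<open>c * z\<close> while
  some exceedance functional is at most \<open>\<eta>\<close>, which is negligible by hypothesis as \<open>\<eta>\<close> tends to
  \<open>0\<close> (\<open>expectation_undamped_error\<close>, \<open>undamped_tendsto\<close>).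

  The same expansion with \<open>H = 1\<close> bounds \<open>\<nu>\<close> on \<open>{f. nrm_sup nrm Q (KQ n) f > 1}\<close> by the
  normalised tail of the supremum (\<open>emeasure_nrm_sup_finite\<close>). An arbitrary threshold
  \<open>e\<close> in place of \<open>c\<close> is reached by rescaling with \<open>e / c\<close>: regular variation of
  \<open>nrm t0 X\<close> produces the factor \<open>(e / c) powr - \<alpha>\<close>, which homogeneity of \<open>\<nu>\<close> cancels
  (\<open>scaled_law_integral_tendsto\<close>). The description of the boundedness reduces every test
  function to this case.
\<close>

section \<open>Weak convergence and almost surely continuous functions\<close>

text \<open>
  The infimal convolution of \<open>G\<close> with \<open>k * dist\<close> is the largest \<open>k\<close>-Lipschitz minorant of
  \<open>G\<close>. A lower bound \<open>b\<close> of \<open>G\<close> near \<open>x\<close> is inherited at \<open>x\<close> once \<open>k\<close> is so large that points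
  at distance at least \<open>d\<close> cannot compete; hence the minorants increase to \<open>G\<close> at every
  continuity point of \<open>G\<close> as \<open>k\<close> grows.
\<close>

lemma lipschitz_minorant:
  fixes G :: "'a::metric_space \<Rightarrow> real" and k :: real
  assumes bound: "\<And>x. \<bar>G x\<bar> \<le> C" and k: "k \<ge> 0"
  defines "L \<equiv> (\<lambda>x. INF y. G y + k * dist x y)"
  shows "L x \<le> G x" and "\<bar>L x\<bar> \<le> C" and "continuous_on UNIV L"
    and "d > 0 \<Longrightarrow> k * d \<ge> 2 * C \<Longrightarrow> (\<And>y. dist x y < d \<Longrightarrow> b \<le> G y) \<Longrightarrow> b \<le> L x"
proof -
  have lower: "- C \<le> G y + k * dist x y" for x y
    using bound[of y] mult_nonneg_nonneg[OF k zero_le_dist[of x y]] by linarith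
  have bdd: "bdd_below (range (\<lambda>y. G y + k * dist x y))" for x
    by (rule bdd_belowI[of _ "- C"]) (use lower in auto)
  have le: "L x \<le> G y + k * dist x y" for x y
    unfolding L_def by (rule cINF_lower[OF bdd]) simp
  have ge: "b \<le> L x" if "\<And>y. b \<le> G y + k * dist x y" for b x
    unfolding L_def by (rule cINF_greatest) (use that in auto)
  show L_le: "L x \<le> G x" for x
    using le[of x x] by simp
  show "\<bar>L x\<bar> \<le> C" for x
    using L_le[of x] ge[of "- C" x] lower bound[of x] by fastforce
  have lip: "L x \<le> L x' + k * dist x x'" for x x'
  proof -
    have "L x - k * dist x x' \<le> G y + k * dist x' y" for y
      using le[of x y] mult_left_mono[OF dist_triangle[of x y x'] k] by (simp add: algebra_simps)
    from ge[OF this] show ?thesis by simp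
  qed
  have "dist (L x) (L y) \<le> k * dist x y" for x y
    using lip[of x y] lip[of y x] by (simp add: dist_real_def dist_commute)
  then show "continuous_on UNIV L"
    by (intro lipschitz_on_continuous_on[of k] lipschitz_onI k) auto
  assume d: "d > 0" "k * d \<ge> 2 * C" and near: "\<And>y. dist x y < d \<Longrightarrow> b \<le> G y"
  have "b \<le> C" using near[of x] d bound[of x] by simp
  show "b \<le> L x"
  proof (rule ge)
    fix y
    show "b \<le> G y + k * dist x y"
    proof (cases "dist x y < d")
      case True
      then show ?thesis using near[of y] mult_nonneg_nonneg[OF k zero_le_dist[of x y]] by linarith
    next
      case False
      then have "k * dist x y \<ge> 2 * C"
        using d mult_left_mono[of d "dist x y" k] k by linarith
      then show ?thesis using \<open>b \<le> C\<close> bound[of y] by linarith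
    qed
  qed
qed

text \<open>
  Weak convergence applies to the Lipschitz minorants of \<open>G\<close>, and by dominated convergence
  their integrals against the limit approximate that of \<open>G\<close>, since almost every point is a
  continuity point.
\<close>

lemma weakly_converges_lower_bound:
  fixes G :: "'a::metric_space \<Rightarrow> real"
  assumes conv: "weakly_converges \<mu> \<nu> F"
    and \<mu>: "\<forall>\<^sub>F z in F. prob_space (\<mu> z) \<and> sets (\<mu> z) = sets borel"
    and \<nu>: "prob_space \<nu>" "sets \<nu> = sets borel"
    and G: "G \<in> borel_measurable borel" "\<And>x. \<bar>G x\<bar> \<le> C"
    and cont: "AE x in \<nu>. isCont G x"
    and a: "a < integral\<^sup>L \<nu> G"
  shows "\<forall>\<^sub>F z in F. a < integral\<^sup>L (\<mu> z) G"
proof -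
  define L where "L k x = (INF y. G y + real k * dist x y)" for k :: nat and x
  have L_le: "L k x \<le> G x" and L_bound: "\<bar>L k x\<bar> \<le> C" and L_cont: "continuous_on UNIV (L k)"
    and L_ge: "d > 0 \<Longrightarrow> real k * d \<ge> 2 * C \<Longrightarrow> (\<And>y. dist x y < d \<Longrightarrow> b \<le> G y) \<Longrightarrow> b \<le> L k x" 
    for k x d b
    using lipschitz_minorant[of G C "real k", OF G(2)] unfolding L_def by auto
  have L_meas [measurable]: "L k \<in> borel_measurable borel" for k
    using L_cont by (rule borel_measurable_continuous_onI)
  note G(1)[measurable]
  have lim: "(\<lambda>k. L k x) \<longlonglongrightarrow> G x" if isCont: "isCont G x" for x
  proof (rule LIMSEQ_I)
    fix e :: real assume e: "e > 0"
    from isCont[unfolded continuous_at_eps_delta, THEN spec, THEN mp, OF half_gt_zero[OF e]]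
    obtain d where d: "d > 0" "\<And>y. dist y x < d \<Longrightarrow> dist (G y) (G x) < e / 2"
      by blast
    obtain N where N: "real N \<ge> 2 * C / d"
      using real_arch_simple by blast
    show "\<exists>N. \<forall>k\<ge>N. norm (L k x - G x) < e"
    proof (intro exI[of _ N] allI impI)
      fix k assume "k \<ge> N"
      then have "2 * C / d \<le> real k"
        using N by linarith
      then have "real k * d \<ge> 2 * C"
        using d(1) by (simp add: pos_divide_le_eq)
      moreover have "G x - e / 2 \<le> G y" if y: "dist x y < d" for y
      proof -
        have "dist (G y) (G x) < e / 2"
          by (rule d(2)) (subst dist_commute, rule y)
        then have "\<bar>G y - G x\<bar> < e / 2" by (simp only: dist_real_def)
        then show ?thesis by linarith
      qed
      ultimately have "G x - e / 2 \<le> L k x"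
        by (intro L_ge[OF d(1)])
      then show "norm (L k x - G x) < e"
        using L_le[of k x] e by simp
    qed
  qed
  interpret \<nu>: prob_space \<nu> by fact
  have meas_\<nu>: "G \<in> borel_measurable \<nu>" "L k \<in> borel_measurable \<nu>" for k
    using measurable_cong_sets[OF \<nu>(2) refl] G(1) L_meas by blast+
  have "(\<lambda>k. integral\<^sup>L \<nu> (L k)) \<longlonglongrightarrow> integral\<^sup>L \<nu> G"
  proof (rule integral_dominated_convergence[where w="\<lambda>_. C"])
    show "AE x in \<nu>. (\<lambda>k. L k x) \<longlonglongrightarrow> G x"
      using cont lim by auto
  qed (use meas_\<nu> L_bound in auto)
  then have "\<forall>\<^sub>F k in sequentially. a < integral\<^sup>L \<nu> (L k)"
    using a order_tendstoD(1) by blast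
  then obtain k where k: "a < integral\<^sup>L \<nu> (L k)"
    by (meson eventually_at_top_linorder order_refl)
  have "((\<lambda>z. integral\<^sup>L (\<mu> z) (L k)) \<longlongrightarrow> integral\<^sup>L \<nu> (L k)) F"
    using conv L_cont[of k] boundedI[of "range (L k)" C] L_bound[of k]
    unfolding weakly_converges_def by auto
  then have "\<forall>\<^sub>F z in F. a < integral\<^sup>L (\<mu> z) (L k)"
    using k order_tendstoD(1) by blast
  with \<mu> show ?thesis
  proof eventually_elim
    case (elim z)
    interpret z: prob_space "\<mu> z" using elim by simp
    have meas: "G \<in> borel_measurable (\<mu> z)" "L k \<in> borel_measurable (\<mu> z)"
      using measurable_cong_sets[of "\<mu> z" borel borel borel] G(1) L_meas elim by blast+
    have "integral\<^sup>L (\<mu> z) (L k) \<le> integral\<^sup>L (\<mu> z) G"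
      by (intro integral_mono z.integrable_const_bound[of _ C] AE_I2)
        (use meas G(2) L_bound L_le in auto)
    with elim show ?case by simp
  qed
qed

text \<open>
  The continuous mapping theorem in the form needed here. The upper bound is the lower bound
  for \<open>- G\<close>.
\<close>

lemma weakly_converges_AE_continuous:
  fixes G :: "'a::metric_space \<Rightarrow> real"
  assumes conv: "weakly_converges \<mu> \<nu> F"
    and \<mu>: "\<forall>\<^sub>F z in F. prob_space (\<mu> z) \<and> sets (\<mu> z) = sets borel"
    and \<nu>: "prob_space \<nu>" "sets \<nu> = sets borel"
    and G: "G \<in> borel_measurable borel" "\<And>x. \<bar>G x\<bar> \<le> C"
    and cont: "AE x in \<nu>. isCont G x"
  shows "((\<lambda>z. integral\<^sup>L (\<mu> z) G) \<longlongrightarrow> integral\<^sup>L \<nu> G) F"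
proof (rule order_tendstoI)
  fix a assume "a < integral\<^sup>L \<nu> G"
  then show "\<forall>\<^sub>F z in F. a < integral\<^sup>L (\<mu> z) G"
    by (rule weakly_converges_lower_bound[OF conv \<mu> \<nu> G cont])
next
  fix a assume "a > integral\<^sup>L \<nu> G"
  moreover have "AE x in \<nu>. isCont (\<lambda>x. - G x) x"
    using cont by eventually_elim (rule continuous_minus)
  ultimately have "\<forall>\<^sub>F z in F. - a < integral\<^sup>L (\<mu> z) (\<lambda>x. - G x)"
    using G by (intro weakly_converges_lower_bound[OF conv \<mu> \<nu>, of _ C]) auto
  then show "\<forall>\<^sub>F z in F. integral\<^sup>L (\<mu> z) G < a"
    by simp
qed

section \<open>Gluing measures\<close>

text \<open>
  Disjointifying the sets \<open>D n\<close> assigns to each point one of the measures that may be used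
  there, and compatibility makes the choice irrelevant. The glued measure charges nothing
  outside the union of the \<open>D n\<close>.
\<close>

lemma glue_measures:
  fixes \<mu> :: "nat \<Rightarrow> 'a measure" and D :: "nat \<Rightarrow> 'a set"
  assumes \<mu>: "\<And>n. sets (\<mu> n) = sets N"
    and D: "\<And>n. D n \<in> sets N"
    and compatible: "\<And>m n A. A \<in> sets N \<Longrightarrow> A \<subseteq> D m \<Longrightarrow> A \<subseteq> D n \<Longrightarrow>
      emeasure (\<mu> m) A = emeasure (\<mu> n) A"
  obtains \<nu> where "sets \<nu> = sets N"
    and "\<And>n A. A \<in> sets N \<Longrightarrow> A \<subseteq> D n \<Longrightarrow> emeasure \<nu> A = emeasure (\<mu> n) A"
    and "\<And>A. A \<in> sets N \<Longrightarrow> (\<And>n. A \<inter> D n = {}) \<Longrightarrow> emeasure \<nu> A = 0"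
proof -
  define E where "E = disjointed D"
  have E [measurable]: "E n \<in> sets N" for n
    unfolding E_def using D sets.range_disjointed_sets[of D N] by auto
  have E_disj: "disjoint_family E" and E_sub: "E n \<subseteq> D n" and E_UN: "(\<Union>n. E n) = (\<Union>n. D n)" for n
    unfolding E_def by (auto simp: disjoint_family_disjointed disjointed_subset UN_disjointed_eq)
  define v where "v A = (\<Sum>n. emeasure (\<mu> n) (A \<inter> E n))" for A
  define \<nu> where "\<nu> = measure_of (space N) (sets N) v"
  have sets_\<nu>: "sets \<nu> = sets N"
    by (simp add: \<nu>_def)
  have "countably_additive (sets N) v"
  proof (rule countably_additiveI)
    fix A :: "nat \<Rightarrow> 'a set"
    assume A: "range A \<subseteq> sets N" "disjoint_family A"
    have "(\<Sum>i. v (A i)) = (\<Sum>i. \<Sum>n. emeasure (\<mu> n) (A i \<inter> E n))"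
      by (simp add: v_def)
    also have "\<dots> = (\<Sum>n. \<Sum>i. emeasure (\<mu> n) (A i \<inter> E n))"
      by (subst (1 2) nn_integral_count_space_nat[symmetric]) (rule nn_integral_suminf, simp)
    also have "\<dots> = (\<Sum>n. emeasure (\<mu> n) (\<Union>i. A i \<inter> E n))"
      using A by (intro suminf_cong suminf_emeasure)
        (auto simp: \<mu> disjoint_family_on_def)
    also have "\<dots> = v (\<Union>i. A i)"
      by (simp add: v_def)
    finally show "(\<Sum>i. v (A i)) = v (\<Union>i. A i)" .
  qed
  moreover have "positive (sets N) v"
    by (simp add: positive_def v_def)
  ultimately have \<nu>_eq: "emeasure \<nu> A = v A" if "A \<in> sets N" for A
    unfolding \<nu>_def using that sets.sigma_algebra_axioms[of N]
    by (intro emeasure_measure_of_sigma) auto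
  show thesis
  proof (rule that[OF sets_\<nu>])
    fix n A assume A: "A \<in> sets N" "A \<subseteq> D n"
    have "v A = (\<Sum>i. emeasure (\<mu> n) (A \<inter> E i))"
      unfolding v_def using A E_sub by (intro suminf_cong compatible) auto
    also have "\<dots> = emeasure (\<mu> n) (\<Union>i. A \<inter> E i)"
      using A E_disj by (intro suminf_emeasure) (auto simp: \<mu> disjoint_family_on_def)
    also have "(\<Union>i. A \<inter> E i) = A"
      using A E_UN by auto
    finally show "emeasure \<nu> A = emeasure (\<mu> n) A"
      using A \<nu>_eq by simp
  next
    fix A assume A: "A \<in> sets N" "\<And>n. A \<inter> D n = {}"
    then have "A \<inter> E n = {}" for n using E_sub[of n] by blast
    then show "emeasure \<nu> A = 0" using A by (simp add: \<nu>_eq v_def)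
  qed
qed

lemma measure_eqI_cover:
  fixes D :: "nat \<Rightarrow> 'a set"
  assumes sets: "sets \<mu> = sets \<nu>"
    and D: "\<And>n. D n \<in> sets \<mu>"
    and eq: "\<And>n A. A \<in> sets \<mu> \<Longrightarrow> A \<subseteq> D n \<Longrightarrow> emeasure \<mu> A = emeasure \<nu> A"
    and eq_off: "\<And>A. A \<in> sets \<mu> \<Longrightarrow> (\<And>n. A \<inter> D n = {}) \<Longrightarrow> emeasure \<mu> A = emeasure \<nu> A"
  shows "\<mu> = \<nu>"
proof (rule measure_eqI[OF sets])
  fix A assume A: "A \<in> sets \<mu>"
  have Un: "(\<Union>n. D n) \<in> sets \<mu>" using D by auto
  have E: "A \<inter> disjointed D n \<in> sets \<mu>" for n
    using A D sets.range_disjointed_sets[of D \<mu>] by auto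
  have split: "emeasure \<kappa> A = emeasure \<kappa> (A - (\<Union>n. D n)) + (\<Sum>n. emeasure \<kappa> (A \<inter> disjointed D n))"
    if "sets \<kappa> = sets \<mu>" for \<kappa>
  proof -
    have "(\<Sum>n. emeasure \<kappa> (A \<inter> disjointed D n)) = emeasure \<kappa> (\<Union>n. A \<inter> disjointed D n)"
      using E that disjoint_family_on_bisimulation[OF disjoint_family_disjointed[of D], of "\<lambda>n. A \<inter> disjointed D n"]
      by (intro suminf_emeasure) auto
    also have "(\<Union>n. A \<inter> disjointed D n) = A \<inter> (\<Union>n. D n)"
      using UN_disjointed_eq[of D] by auto
    finally have sum: "(\<Sum>n. emeasure \<kappa> (A \<inter> disjointed D n)) = emeasure \<kappa> (A \<inter> (\<Union>n. D n))" .
    have "A - (\<Union>n. D n) \<in> sets \<kappa>" "A \<inter> (\<Union>n. D n) \<in> sets \<kappa>"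
      unfolding that using A Un by (rule sets.Diff sets.Int)+
    then have "emeasure \<kappa> (A - (\<Union>n. D n)) + emeasure \<kappa> (A \<inter> (\<Union>n. D n)) =
        emeasure \<kappa> ((A - (\<Union>n. D n)) \<union> (A \<inter> (\<Union>n. D n)))"
      by (rule plus_emeasure) blast
    also have "(A - (\<Union>n. D n)) \<union> (A \<inter> (\<Union>n. D n)) = A" by blast
    finally show ?thesis unfolding sum by (rule sym)
  qed
  have "emeasure \<mu> (A \<inter> disjointed D n) = emeasure \<nu> (A \<inter> disjointed D n)" for n
    using E[of n] disjointed_subset[of D n] by (intro eq) auto
  moreover have "emeasure \<mu> (A - (\<Union>n. D n)) = emeasure \<nu> (A - (\<Union>n. D n))"
    using A Un by (intro eq_off) auto
  ultimately show "emeasure \<mu> A = emeasure \<nu> A"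
    using split[of \<mu>] split[of \<nu>] sets by simp
qed

section \<open>The tail measure of a family of tail processes\<close>

lemma nn_integral_indicator_compose:
  assumes "Z \<in> M \<rightarrow>\<^sub>M N" "A \<in> sets N"
  shows "(\<integral>\<^sup>+\<omega>. indicator A (Z \<omega>) \<partial>M) = emeasure M {\<omega>\<in>space M. Z \<omega> \<in> A}"
proof -
  have "(\<integral>\<^sup>+\<omega>. indicator A (Z \<omega>) \<partial>M) = (\<integral>\<^sup>+x. indicator A x \<partial>distr M N Z)"
    using assms by (subst nn_integral_distr) auto
  also have "\<dots> = emeasure M (Z -` A \<inter> space M)"
    using assms by (simp add: emeasure_distr)
  also have "Z -` A \<inter> space M = {\<omega>\<in>space M. Z \<omega> \<in> A}" by auto
  finally show ?thesis .
qed

context homogeneous_setting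
begin

lemma act_act: "z1 > 0 \<Longrightarrow> z2 > 0 \<Longrightarrow> act z1 (act z2 f) = act (z1 * z2) f"
  by (simp add: act_mult)

lemma vimage_act_eq_image: "z > 0 \<Longrightarrow> act (1 / z) -` A = act z ` A"
  using act_image_iff[of z _ A] by auto

lemma nrm_sets [measurable]: "h \<in> Q \<Longrightarrow> {f. nrm h f > r} \<in> sets borel"
  using nrm_measurable[of h] by measurable

lemma act_image_sets: "z > 0 \<Longrightarrow> A \<in> sets borel \<Longrightarrow> act z ` A \<in> sets borel"
  using measurable_sets[OF act_measurable_fixed[of "1 / z"], of A]
  by (simp add: vimage_act_eq_image)

lemma act_measurable_compose:
  assumes "Z \<in> M \<rightarrow>\<^sub>M borel" "z > 0"
  shows "(\<lambda>\<omega>. act z (Z \<omega>)) \<in> M \<rightarrow>\<^sub>M borel"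
  using measurable_compose[OF assms(1) act_measurable_fixed[OF assms(2)]] .

text \<open>
  If both weights are positive, this is the defining identity of a family of tail processes at
  \<open>x = s / r\<close>, applied to the indicator function of \<open>{f. act r f \<in> A}\<close>: the restriction of \<open>A\<close>
  to \<open>nrm h f > r\<close> and \<open>nrm t f > s\<close> makes the indicators in that identity disappear. If
  exactly one weight vanishes, the corresponding norm of the other process is almost surely
  \<open>0\<close>, so both sides are \<open>0\<close>.
\<close>

lemma tail_family_consistent:
  assumes family: "tail_process_family act nrm Q \<alpha> p M Y" and M: "prob_space M"
    and h: "h \<in> Q" and t: "t \<in> Q" and r: "r > 0" and s: "s > 0"
    and A: "A \<in> sets borel" "A \<subseteq> {f. nrm h f > r}" "A \<subseteq> {f. nrm t f > s}"
  shows "ennreal (p h * r powr - \<alpha>) * emeasure M {\<omega>\<in>space M. act r (Y h \<omega>) \<in> A} =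
    ennreal (p t * s powr - \<alpha>) * emeasure M {\<omega>\<in>space M. act s (Y t \<omega>) \<in> A}"
proof -
  interpret prob_space M by fact
  have nonneg: "p h \<ge> 0" "p t \<ge> 0"
    and Y [measurable]: "\<And>h. h \<in> Q \<Longrightarrow> Y h \<in> M \<rightarrow>\<^sub>M borel"
    and null: "\<And>h t. h \<in> Q \<Longrightarrow> t \<in> Q \<Longrightarrow> p h = 0 \<Longrightarrow> p t > 0 \<Longrightarrow>
      prob {\<omega>\<in>space M. nrm h (Y t \<omega>) = 0} = 1"
    using family h t unfolding tail_process_family_def by auto
  have identity: "\<forall>h\<in>Q. \<forall>t\<in>Q. p h * p t > 0 \<longrightarrow> (\<forall>x>0. \<forall>\<Gamma> :: 'd \<Rightarrow> ennreal. \<Gamma> \<in> borel_measurable borel \<longrightarrow>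
      ennreal (p h) *
        (\<integral>\<^sup>+\<omega>. \<Gamma> (act x (Y h \<omega>)) * indicator {f. x * nrm t f > 1} (Y h \<omega>) \<partial>M) =
      ennreal (p t * x powr \<alpha>) *
        (\<integral>\<^sup>+\<omega>. \<Gamma> (Y t \<omega>) * indicator {f. nrm h f > x} (Y t \<omega>) \<partial>M))"
    using family unfolding tail_process_family_def by blast
  have vanish: "emeasure M {\<omega>\<in>space M. act s (Y t \<omega>) \<in> A} = 0"
    if "h \<in> Q" "t \<in> Q" "p h = 0" "p t > 0" "r > 0" "s > 0" "A \<subseteq> {f. nrm h f > r}" for h t r s
  proof -
    have "AE \<omega> in M. nrm h (Y t \<omega>) = 0"
      using null[OF that(1-4)] that nrm_measurable[of h] Y
      by (subst (asm) prob_eq_1) auto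
    then have "AE \<omega> in M. act s (Y t \<omega>) \<notin> A"
      using that nrm_homogeneous[of h s] by (elim eventually_mono) fastforce
    then show ?thesis
      by (simp add: AE_iff_measurable[OF _ refl] emeasure_eq_0_AE)
  qed
  show ?thesis
  proof (cases "p h > 0 \<and> p t > 0")
    case True
    \<comment> \<open>Composing the indicator with \<open>act r\<close> turns \<open>act (s / r) (Y t)\<close> into \<open>act s (Y t)\<close>.\<close>
    define \<Gamma> :: "'d \<Rightarrow> ennreal" where "\<Gamma> f = indicator A (act r f)" for f
    have \<Gamma>: "\<Gamma> \<in> borel_measurable borel"
      unfolding \<Gamma>_def using act_measurable_fixed[OF r] A by measurable
    have mY: "(\<lambda>\<omega>. act r (Y h \<omega>)) \<in> M \<rightarrow>\<^sub>M borel" "(\<lambda>\<omega>. act s (Y t \<omega>)) \<in> M \<rightarrow>\<^sub>M borel"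
      by (intro act_measurable_compose Y h t r s)+
    have "ennreal (p t) * (\<integral>\<^sup>+\<omega>. \<Gamma> (act (s / r) (Y t \<omega>)) *
          indicator {f. s / r * nrm h f > 1} (Y t \<omega>) \<partial>M) =
        ennreal (p h * (s / r) powr \<alpha>) *
          (\<integral>\<^sup>+\<omega>. \<Gamma> (Y h \<omega>) * indicator {f. nrm t f > s / r} (Y h \<omega>) \<partial>M)"
      using True r s by (intro identity[rule_format, OF t h _ _ \<Gamma>]) auto
    also have "(\<lambda>\<omega>. \<Gamma> (act (s / r) (Y t \<omega>)) * indicator {f. s / r * nrm h f > 1} (Y t \<omega>)) =
        (\<lambda>\<omega>. indicator A (act s (Y t \<omega>)))"
      using A(2) nrm_homogeneous[OF h s] r s
      by (auto simp: \<Gamma>_def act_act indicator_def fun_eq_iff field_simps)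
    also have "(\<lambda>\<omega>. \<Gamma> (Y h \<omega>) * indicator {f. nrm t f > s / r} (Y h \<omega>)) =
        (\<lambda>\<omega>. indicator A (act r (Y h \<omega>)))"
      using A(3) nrm_homogeneous[OF t r] r s
      by (auto simp: \<Gamma>_def indicator_def fun_eq_iff field_simps)
    also have "(\<integral>\<^sup>+\<omega>. indicator A (act s (Y t \<omega>)) \<partial>M) = emeasure M {\<omega>\<in>space M. act s (Y t \<omega>) \<in> A}"
      using mY A by (intro nn_integral_indicator_compose)
    also have "(\<integral>\<^sup>+\<omega>. indicator A (act r (Y h \<omega>)) \<partial>M) = emeasure M {\<omega>\<in>space M. act r (Y h \<omega>) \<in> A}"
      using mY A by (intro nn_integral_indicator_compose)
    finally have eq: "ennreal (p t) * emeasure M {\<omega>\<in>space M. act s (Y t \<omega>) \<in> A} =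
      ennreal (p h * (s / r) powr \<alpha>) * emeasure M {\<omega>\<in>space M. act r (Y h \<omega>) \<in> A}" .
    have "(s / r) powr \<alpha> * s powr - \<alpha> = r powr - \<alpha>"
      using r s by (simp add: powr_divide powr_minus field_simps)
    then have "p h * r powr - \<alpha> = s powr - \<alpha> * (p h * (s / r) powr \<alpha>)"
      by (simp add: algebra_simps)
    then have 1: "ennreal (p h * r powr - \<alpha>) = ennreal (s powr - \<alpha>) * ennreal (p h * (s / r) powr \<alpha>)"
      by (simp only:) (rule ennreal_mult, use nonneg in auto)
    have 2: "ennreal (p t * s powr - \<alpha>) = ennreal (s powr - \<alpha>) * ennreal (p t)"
      unfolding mult.commute[of "p t"] by (rule ennreal_mult) (use nonneg in auto)
    show ?thesis
      unfolding 1 2 mult.assoc eq ..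
  next
    case False
    then consider "p h = 0" "p t = 0" | "p h = 0" "p t > 0" | "p h > 0" "p t = 0"
      using nonneg by linarith
    then show ?thesis
      using vanish[OF h t _ _ r s A(2)] vanish[OF t h _ _ s r A(3)] by cases auto
  qed
qed

text \<open>
  The levels \<open>1 / Suc k\<close> suffice for gluing: a set inside \<open>{f. nrm h f > r}\<close> is also inside
  \<open>{f. nrm h f > 1 / Suc k}\<close> for some \<open>k\<close>, and consistency converts the formula from one level
  to the other.
\<close>

theorem tail_measure_of_family:
  assumes family: "tail_process_family act nrm Q \<alpha> p M Y" and M: "prob_space M"
  obtains \<nu> where "sets \<nu> = sets borel"
    and "\<And>h r A. h \<in> Q \<Longrightarrow> r > 0 \<Longrightarrow> A \<in> sets borel \<Longrightarrow> A \<subseteq> {f. nrm h f > r} \<Longrightarrow>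
      emeasure \<nu> A = ennreal (p h * r powr - \<alpha>) * emeasure M {\<omega>\<in>space M. act r (Y h \<omega>) \<in> A}"
    and "\<And>z A. z > 0 \<Longrightarrow> A \<in> sets borel \<Longrightarrow>
      emeasure \<nu> (act z ` A) = ennreal (z powr - \<alpha>) * emeasure \<nu> A"
    and "\<And>A. A \<in> sets borel \<Longrightarrow> (\<And>h f. h \<in> Q \<Longrightarrow> f \<in> A \<Longrightarrow> nrm h f = 0) \<Longrightarrow> emeasure \<nu> A = 0"
proof -
  have p: "h \<in> Q \<Longrightarrow> p h \<ge> 0" and Y: "h \<in> Q \<Longrightarrow> Y h \<in> M \<rightarrow>\<^sub>M borel" for h
    using family unfolding tail_process_family_def by auto
  define e where "e = from_nat_into (Q \<times> (UNIV :: nat set))"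
  define \<mu> where "\<mu> n = (case e n of (h, k) \<Rightarrow>
    scale_measure (ennreal (p h * (1 / Suc k) powr - \<alpha>))
      (distr M borel (\<lambda>\<omega>. act (1 / Suc k) (Y h \<omega>))))" for n
  define D where "D n = (case e n of (h, k) \<Rightarrow> {f. nrm h f > 1 / Suc k})" for n
  have range_e: "range e = Q \<times> UNIV"
    unfolding e_def using Q_countable Q_nonempty by (intro range_from_nat_into) auto
  have e: "\<exists>h k. e n = (h, k) \<and> h \<in> Q" for n
    using range_e by (metis mem_Sigma_iff prod.collapse rangeI)
  have e_onto: "\<exists>n. e n = (h, k)" if "h \<in> Q" for h k
    using range_e that by (metis (no_types, lifting) SigmaI UNIV_I imageE)
  have cover: "\<exists>n. f \<in> D n" if h: "h \<in> Q" and pos: "nrm h f > 0" for h f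
  proof -
    obtain k where "1 / Suc k < nrm h f"
      using nat_approx_posE[OF pos] by blast
    moreover obtain n where "e n = (h, k)" using e_onto[OF h] by blast
    ultimately have "f \<in> D n" by (simp add: D_def)
    then show ?thesis by blast
  qed
  have D: "D n \<in> sets borel" for n
    using e[of n] nrm_sets by (auto simp: D_def)
  have \<mu>_eq: "emeasure (\<mu> n) A =
      ennreal (p h * (1 / Suc k) powr - \<alpha>) * emeasure M {\<omega>\<in>space M. act (1 / Suc k) (Y h \<omega>) \<in> A}"
    if "e n = (h, k)" "A \<in> sets borel" for n h k A
  proof -
    have "h \<in> Q" using e[of n] that by auto
    then have "(\<lambda>\<omega>. act (1 / Suc k) (Y h \<omega>)) \<in> M \<rightarrow>\<^sub>M borel"
      by (intro act_measurable_compose Y) auto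
    then show ?thesis
      unfolding \<mu>_def using that by (simp add: emeasure_distr vimage_def Int_def conj_commute)
  qed
  obtain \<nu> where sets_\<nu>: "sets \<nu> = sets borel"
    and glue: "\<And>n A. A \<in> sets borel \<Longrightarrow> A \<subseteq> D n \<Longrightarrow> emeasure \<nu> A = emeasure (\<mu> n) A"
    and off: "\<And>A. A \<in> sets borel \<Longrightarrow> (\<And>n. A \<inter> D n = {}) \<Longrightarrow> emeasure \<nu> A = 0"
  proof (rule glue_measures[where \<mu> = \<mu> and N = borel and D = D])
    show "sets (\<mu> n) = sets borel" for n
      by (simp add: \<mu>_def split: prod.split)
    show "D n \<in> sets borel" for n by fact
    fix m n :: nat and A assume A: "A \<in> sets borel" "A \<subseteq> D m" "A \<subseteq> D n"
    obtain h k t l where e': "e m = (h, k)" "h \<in> Q" "e n = (t, l)" "t \<in> Q"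
      using e by metis
    show "emeasure (\<mu> m) A = emeasure (\<mu> n) A"
      using A e' unfolding \<mu>_eq[OF e'(1) A(1)] \<mu>_eq[OF e'(3) A(1)]
      by (intro tail_family_consistent[OF family M]) (auto simp: D_def)
  qed (use that in blast)
  have level: "emeasure \<nu> A = ennreal (p h * r powr - \<alpha>) * emeasure M {\<omega>\<in>space M. act r (Y h \<omega>) \<in> A}"
    if h: "h \<in> Q" and r: "r > 0" and A: "A \<in> sets borel" "A \<subseteq> {f. nrm h f > r}" for h r A
  proof -
    obtain k where k: "1 / Suc k < r" using nat_approx_posE[OF r] by blast
    obtain n where n: "e n = (h, k)" using e_onto[OF h] by blast
    have "A \<subseteq> {f. nrm h f > 1 / Suc k}" using A(2) k by force
    moreover from this have "emeasure \<nu> A = emeasure (\<mu> n) A"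
      using n by (intro glue A) (simp add: D_def)
    ultimately show ?thesis
      unfolding \<mu>_eq[OF n A(1)]
      using h r A by (simp only:) (rule tail_family_consistent[OF family M], auto)
  qed
  have hom: "emeasure \<nu> (act z ` A) = ennreal (z powr - \<alpha>) * emeasure \<nu> A"
    if z: "z > 0" and A: "A \<in> sets borel" for z A
  proof -
    \<comment> \<open>The measure \<open>\<nu>'\<close> satisfies the prescriptions that determine \<open>\<nu>\<close>, hence equals it.\<close>
    define \<nu>' where "\<nu>' = scale_measure (ennreal (z powr \<alpha>)) (distr \<nu> borel (act (1 / z)))"
    have \<nu>': "emeasure \<nu>' A = ennreal (z powr \<alpha>) * emeasure \<nu> (act z ` A)" if "A \<in> sets borel" for A
    proof -
      have "act (1 / z) \<in> \<nu> \<rightarrow>\<^sub>M borel"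
        using act_measurable_fixed[of "1 / z"] z sets_\<nu> by (simp cong: measurable_cong_sets)
      moreover have "space \<nu> = UNIV"
        using sets_eq_imp_space_eq[OF sets_\<nu>] by simp
      ultimately show ?thesis
        using that z by (simp add: \<nu>'_def emeasure_distr vimage_act_eq_image)
    qed
    have "\<nu>' = \<nu>"
    proof (rule measure_eqI_cover[where D = D])
      fix n A assume "A \<in> sets \<nu>'" and AD: "A \<subseteq> D n"
      then have A: "A \<in> sets borel" by (simp add: \<nu>'_def)
      obtain h k where e': "e n = (h, k)" "h \<in> Q" using e by blast
      define r :: real where "r = 1 / Suc k"
      have r: "r > 0" by (simp add: r_def)
      have Ar: "A \<subseteq> {f. nrm h f > r}" using AD e' by (simp add: D_def r_def)
      then have "act z ` A \<subseteq> {f. nrm h f > z * r}"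
        using nrm_homogeneous[OF e'(2) z] z by auto
      then have "emeasure \<nu> (act z ` A) = ennreal (p h * (z * r) powr - \<alpha>) *
          emeasure M {\<omega>\<in>space M. act (z * r) (Y h \<omega>) \<in> act z ` A}"
        using r z A by (intro level e' act_image_sets) auto
      also have "(\<lambda>\<omega>. act (z * r) (Y h \<omega>) \<in> act z ` A) = (\<lambda>\<omega>. act r (Y h \<omega>) \<in> A)"
        using act_image_iff[OF z] r z by (simp add: act_act)
      also have "p h * (z * r) powr - \<alpha> = z powr - \<alpha> * (p h * r powr - \<alpha>)"
        using r z by (simp add: powr_mult)
      finally have "emeasure \<nu> (act z ` A) = ennreal (z powr - \<alpha>) * emeasure \<nu> A"
        unfolding level[OF e'(2) r A Ar] using p[OF e'(2)] by (simp add: ennreal_mult mult.assoc)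
      then show "emeasure \<nu>' A = emeasure \<nu> A"
        unfolding \<nu>'[OF A] using z
        by (simp add: mult.assoc[symmetric] ennreal_mult[symmetric] powr_add[symmetric])
    next
      fix A assume "A \<in> sets \<nu>'" and AD: "\<And>n. A \<inter> D n = {}"
      then have A: "A \<in> sets borel" by (simp add: \<nu>'_def)
      have zero: "nrm h f = 0" if "h \<in> Q" "f \<in> A" for h f
        using cover[OF that(1), of f] AD that(2) nrm_nonneg[OF that(1), of f] by fastforce
      have "act z ` A \<inter> D n = {}" for n
      proof -
        obtain h k where "e n = (h, k)" "h \<in> Q" using e by blast
        then show ?thesis
          using zero nrm_homogeneous[of h z] z by (auto simp: D_def)
      qed
      then show "emeasure \<nu>' A = emeasure \<nu> A"
        unfolding \<nu>'[OF A] using off[OF act_image_sets[OF z A]] off[OF A] AD by simp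
    qed (use sets_\<nu> D in \<open>auto simp: \<nu>'_def\<close>)
    then have "emeasure \<nu> A = ennreal (z powr \<alpha>) * emeasure \<nu> (act z ` A)"
      using \<nu>'[OF A] by simp
    then show ?thesis
      using z by (simp add: mult.assoc[symmetric] ennreal_mult[symmetric] powr_add[symmetric])
  qed
  show thesis
  proof (rule that[OF sets_\<nu> level hom])
    fix A assume A: "A \<in> sets borel" "\<And>h f. h \<in> Q \<Longrightarrow> f \<in> A \<Longrightarrow> nrm h f = 0"
    have "A \<inter> D n = {}" for n
      using e[of n] A(2) by (fastforce simp: D_def)
    then show "emeasure \<nu> A = 0" using off A(1) by blast
  qed
qed

end

section \<open>Integrals over scaled, conditioned and counting measures\<close>

lemma integral_scale_measure:
  fixes f :: "'a \<Rightarrow> real"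
  assumes "r \<ge> 0" "f \<in> borel_measurable M"
  shows "integral\<^sup>L (scale_measure (ennreal r) M) f = r * integral\<^sup>L M f"
proof -
  have "scale_measure (ennreal r) M = density M (\<lambda>_. ennreal r)"
    by (rule measure_eqI) (auto simp: emeasure_density_const)
  then show ?thesis
    using assms by (simp add: integral_density)
qed

lemma (in prob_space) integral_uniform_measure:
  fixes f :: "'a \<Rightarrow> real"
  assumes A: "A \<in> events" "prob A > 0" and f: "f \<in> borel_measurable M"
  shows "prob A * integral\<^sup>L (uniform_measure M A) f = expectation (\<lambda>\<omega>. f \<omega> * indicator A \<omega>)"
proof -
  have "indicator A \<omega> / emeasure M A = ennreal (indicator A \<omega> / prob A)" for \<omega>
    using A by (simp add: emeasure_eq_measure divide_ennreal[symmetric] ennreal_indicator)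
  then have "uniform_measure M A = density M (\<lambda>\<omega>. ennreal (indicator A \<omega> / prob A))"
    by (simp add: uniform_measure_def)
  then have "integral\<^sup>L (uniform_measure M A) f = expectation (\<lambda>\<omega>. indicator A \<omega> / prob A * f \<omega>)"
    using A f by (simp add: integral_density)
  also have "\<dots> = expectation (\<lambda>\<omega>. f \<omega> * indicator A \<omega> / prob A)"
    by (simp add: mult.commute)
  finally show ?thesis using A by simp
qed

text \<open>
  Fubini's theorem for a countable sum and an integral, with a summable bound on the absolute
  integrals in place of joint integrability.
\<close>

lemma integral_count_space_swap:
  fixes F :: "'i \<Rightarrow> 'a \<Rightarrow> real"
  assumes N: "sigma_finite_measure N" and K: "countable K"
    and F: "\<And>i. i \<in> K \<Longrightarrow> integrable N (F i)"
    and bound: "\<And>i. i \<in> K \<Longrightarrow> (LINT x|N. \<bar>F i x\<bar>) \<le> b i"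
    and b: "integrable (count_space K) b"
  shows "integrable N (\<lambda>x. LINT i|count_space K. F i x)"
    and "(LINT x|N. LINT i|count_space K. F i x) = (LINT i|count_space K. LINT x|N. F i x)"
proof -
  interpret pair_sigma_finite "count_space K" N
    using N K by (intro pair_sigma_finite.intro sigma_finite_measure_count_space_countable)
  have "integrable (count_space K \<Otimes>\<^sub>M N) (case_prod F)"
  proof (rule Fubini_integrable)
    show "case_prod F \<in> borel_measurable (count_space K \<Otimes>\<^sub>M N)"
      using F by (intro measurable_pair_measure_countable1 K) auto
    show "integrable (count_space K) (\<lambda>i. LINT x|N. norm (case_prod F (i, x)))"
      by (rule Bochner_Integration.integrable_bound[OF b])
        (use bound in \<open>fastforce intro!: AE_I2 simp: abs_of_nonneg\<close>)+
  qed (use F in \<open>auto intro!: AE_I2\<close>)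
  from integrable_snd[OF this] Fubini_integral[OF this]
  show "integrable N (\<lambda>x. LINT i|count_space K. F i x)"
    and "(LINT x|N. LINT i|count_space K. F i x) = (LINT i|count_space K. LINT x|N. F i x)"
    by auto
qed

section \<open>The exceedance functional\<close>

text \<open>
  The real-valued form of the exceedance functional, written as an integral over the index set
  so that Fubini's theorem and dominated convergence apply to sums over \<open>t\<close>.
\<close>

definition real_exceedance :: "('t \<Rightarrow> 'd \<Rightarrow> real) \<Rightarrow> ('t \<Rightarrow> real) \<Rightarrow> 't set \<Rightarrow> 'd \<Rightarrow> real" where
  "real_exceedance nrm q K f = (LINT t|count_space K. q t * indicator {g. nrm t g > 1} f)"

lemma exceedance_eq_real_exceedance:
  assumes q: "integrable (count_space K) q" "\<And>t. t \<in> K \<Longrightarrow> q t \<ge> 0"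
  shows "exceedance nrm q K f = ennreal (real_exceedance nrm q K f)"
proof -
  define a where "a t = q t * indicator {g. nrm t g > 1} f" for t
  have a_nonneg: "t \<in> K \<Longrightarrow> a t \<ge> 0" for t using q(2) by (simp add: a_def)
  have "integrable (count_space K) a"
    by (rule Bochner_Integration.integrable_bound[OF q(1)])
      (auto intro!: AE_I2 simp: a_def split: split_indicator)
  then have abs: "Infinite_Set_Sum.abs_summable_on a K"
    by (simp add: Infinite_Set_Sum.abs_summable_on_def)
  then have "a summable_on K"
    using abs_summable_equivalent abs_summable_summable by blast
  then have "ennreal (infsum a K) = (SUP F\<in>{F. finite F \<and> F \<subseteq> K}. ennreal (sum a F))"
    using a_nonneg by (rule infsum_nonneg_is_SUPREMUM_ennreal)
  also have "\<dots> = (SUP F\<in>{F. finite F \<and> F \<subseteq> K}. \<Sum>t\<in>F. ennreal (a t))"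
    using a_nonneg by (intro SUP_cong refl sum_ennreal[symmetric]) auto
  also have "\<dots> = (\<Sum>\<^sub>\<infinity>t\<in>K. ennreal (a t))"
    by (rule nonneg_infsum_complete[symmetric]) simp
  finally show ?thesis
    using infsetsum_infsum[OF abs]
    by (simp add: exceedance_def real_exceedance_def infsetsum_def a_def mult.commute)
qed

context homogeneous_setting
begin

lemma less_nrm_sup_iff: "r \<ge> 0 \<Longrightarrow> ennreal r < nrm_sup nrm Q K f \<longleftrightarrow> (\<exists>t\<in>K \<inter> Q. r < nrm t f)"
  by (auto simp: nrm_sup_def less_SUP_iff ennreal_less_iff)

lemma nrm_sup_sets: "r \<ge> 0 \<Longrightarrow> {f. nrm_sup nrm Q K f > ennreal r} \<in> sets borel"
proof -
  assume "r \<ge> 0"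
  then have "{f. nrm_sup nrm Q K f > ennreal r} = (\<Union>t\<in>K \<inter> Q. {f. nrm t f > r})"
    by (auto simp: less_nrm_sup_iff)
  then show ?thesis
    using Q_countable nrm_sets by (auto intro!: sets.countable_UN')
qed

lemma real_exceedance_measurable:
  assumes "K \<subseteq> Q"
  shows "real_exceedance nrm q K \<in> borel_measurable borel"
proof -
  have K: "countable K" using assms Q_countable countable_subset by blast
  interpret sigma_finite_measure "count_space K"
    using K by (rule sigma_finite_measure_count_space_countable)
  have "(\<lambda>(t, f). q t * indicator {g. nrm t g > 1} f) \<in> borel_measurable (count_space K \<Otimes>\<^sub>M borel)"
  proof (rule measurable_pair_measure_countable1[OF K])
    fix t assume "t \<in> K"
    then have [measurable]: "{g. nrm t g > 1} \<in> sets borel" using assms nrm_sets by blast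
    show "(\<lambda>f. case (t, f) of (t, f) \<Rightarrow> q t * indicator {g. nrm t g > 1} f) \<in> borel_measurable borel"
      by simp
  qed
  then have "(\<lambda>(f, t). q t * indicator {g. nrm t g > 1} f) \<in> borel_measurable (borel \<Otimes>\<^sub>M count_space K)"
    using measurable_pair_swap by fastforce
  then have "(\<lambda>f. LINT t|count_space K. q t * indicator {g. nrm t g > 1} f) \<in> borel_measurable borel"
    by (rule borel_measurable_lebesgue_integral)
  then show ?thesis by (simp add: real_exceedance_def[abs_def])
qed

end

section \<open>Limits on single exceedance events\<close>

text \<open>
  Besides the hypotheses on \<open>X\<close> and \<open>Y\<close>, the context fixes a measure \<open>\<nu>\<close> with the properties
  delivered by \<open>tail_measure_of_family\<close>, so that the convergence can be studied without
  returning to its construction.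
\<close>

locale regularly_varying_setting =
  homogeneous_setting act nrm T Q KQ + prob_space M
  for act :: "real \<Rightarrow> 'd::polish_space \<Rightarrow> 'd" and nrm :: "'t \<Rightarrow> 'd \<Rightarrow> real"
    and T Q :: "'t set" and KQ :: "nat \<Rightarrow> 't set" and M :: "'w measure" +
  fixes X :: "'w \<Rightarrow> 'd" and Y :: "'t \<Rightarrow> 'w \<Rightarrow> 'd" and t0 :: 't
    and \<alpha> c :: real and p q :: "'t \<Rightarrow> real" and \<nu> :: "'d measure"
  assumes act_continuous: "\<And>z. z > 0 \<Longrightarrow> continuous_on UNIV (act z)"
    and X_random: "X \<in> M \<rightarrow>\<^sub>M borel"
    and Y_random: "\<And>h. h \<in> Q \<Longrightarrow> Y h \<in> M \<rightarrow>\<^sub>M borel"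
    and Y_exceeds: "\<And>h. h \<in> Q \<Longrightarrow> prob {\<omega>\<in>space M. nrm h (Y h \<omega>) > 1} = 1"
    and t0: "t0 \<in> Q"
    and X_t0_regularly_varying: "\<And>t. t > 0 \<Longrightarrow>
      ((\<lambda>z. prob {\<omega>\<in>space M. nrm t0 (X \<omega>) > z * t} /
             prob {\<omega>\<in>space M. nrm t0 (X \<omega>) > z}) \<longlongrightarrow> t powr (-\<alpha>)) at_top"
    and p_nonneg: "\<And>h. h \<in> Q \<Longrightarrow> p h \<ge> 0" and p_t0: "p t0 > 0"
    and tail_ratio: "\<And>h. h \<in> Q \<Longrightarrow>
      ((\<lambda>z. prob {\<omega>\<in>space M. nrm h (X \<omega>) > z} /
             prob {\<omega>\<in>space M. nrm t0 (X \<omega>) > z}) \<longlongrightarrow> p h / p t0) at_top"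
    and conditional_limit: "\<And>h. h \<in> Q \<Longrightarrow> p h > 0 \<Longrightarrow>
      weakly_converges (conditional_scaled_law act nrm M X h) (distr M borel (Y h)) at_top"
    and limsup_finite: "\<And>\<epsilon> K. \<epsilon> > 0 \<Longrightarrow> K \<in> range KQ \<Longrightarrow>
      Limsup at_top (\<lambda>z. ereal
        (prob {\<omega>\<in>space M. nrm_sup nrm Q K (X \<omega>) > ennreal (\<epsilon> * z)} /
         prob {\<omega>\<in>space M. nrm t0 (X \<omega>) > z})) < \<infinity>"
    and c: "c > 1"
    and q_pos: "\<And>t. t \<in> Q \<Longrightarrow> q t > 0"
    and q_summable: "(\<lambda>t. max 1 (p t) * q t) summable_on Q"
    and exceedance_negligible: "\<And>\<epsilon> K. \<epsilon> > 0 \<Longrightarrow> K \<in> range KQ \<Longrightarrow>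
      ((\<lambda>\<eta>. Limsup at_top (\<lambda>z. ereal
        (prob {\<omega>\<in>space M. nrm_sup nrm Q K (X \<omega>) > ennreal (c * \<epsilon> * z) \<and>
                                 exceedance nrm q K (act (1 / (\<epsilon> * z)) (X \<omega>)) \<le> ennreal \<eta>} /
         prob {\<omega>\<in>space M. nrm t0 (X \<omega>) > z}))) \<longlongrightarrow> 0) (at_right 0)"
    and exceedance_continuous: "\<And>h K. h \<in> Q \<Longrightarrow> K \<in> range KQ \<Longrightarrow>
      AE f in distr M borel (Y h). isCont (exceedance nrm q K) f"
    and sets_\<nu>: "sets \<nu> = sets borel"
    and \<nu>_level: "\<And>h r A. h \<in> Q \<Longrightarrow> r > 0 \<Longrightarrow> A \<in> sets borel \<Longrightarrow> A \<subseteq> {f. nrm h f > r} \<Longrightarrow>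
      emeasure \<nu> A = ennreal (p h * r powr - \<alpha>) * emeasure M {\<omega>\<in>space M. act r (Y h \<omega>) \<in> A}"
    and \<nu>_homogeneous: "\<And>z A. z > 0 \<Longrightarrow> A \<in> sets borel \<Longrightarrow>
      emeasure \<nu> (act z ` A) = ennreal (z powr - \<alpha>) * emeasure \<nu> A"
    and \<nu>_off: "\<And>A. A \<in> sets borel \<Longrightarrow> (\<And>h f. h \<in> Q \<Longrightarrow> f \<in> A \<Longrightarrow> nrm h f = 0) \<Longrightarrow> emeasure \<nu> A = 0"
begin

definition tail :: "'t \<Rightarrow> real \<Rightarrow> real" where
  "tail h z = prob {\<omega>\<in>space M. nrm h (X \<omega>) > z}"

definition scaling :: "real \<Rightarrow> real" where
  "scaling z = p t0 / tail t0 z"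

definition scaled :: "real \<Rightarrow> 'w \<Rightarrow> 'd" where
  "scaled z \<omega> = act (1 / z) (X \<omega>)"

abbreviation E :: "'t set \<Rightarrow> 'd \<Rightarrow> real" where
  "E \<equiv> real_exceedance nrm q"

lemma space_\<nu> [simp]: "space \<nu> = UNIV"
  using sets_eq_imp_space_eq[OF sets_\<nu>] by simp

lemma measurable_\<nu>: "measurable \<nu> N = measurable borel N"
  by (rule measurable_cong_sets[OF sets_\<nu> refl])

lemma random_sets:
  assumes "Z \<in> M \<rightarrow>\<^sub>M borel" "A \<in> sets borel"
  shows "{\<omega>\<in>space M. Z \<omega> \<in> A} \<in> events"
  using measurable_sets[OF assms] by (simp add: vimage_def Int_def conj_commute)

lemma nrm_X_sets: "h \<in> Q \<Longrightarrow> {\<omega>\<in>space M. nrm h (X \<omega>) > z} \<in> events"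
  using random_sets[OF X_random nrm_sets[of h z]] by simp

lemma nrm_scaled: "z > 0 \<Longrightarrow> h \<in> Q \<Longrightarrow> nrm h (scaled z \<omega>) = nrm h (X \<omega>) / z"
  by (simp add: scaled_def nrm_homogeneous)

lemma scaled_random: "z > 0 \<Longrightarrow> scaled z \<in> M \<rightarrow>\<^sub>M borel"
  unfolding scaled_def[abs_def] by (intro act_measurable_compose X_random) simp

lemma scaling_nonneg: "scaling z \<ge> 0"
  using p_t0 by (simp add: scaling_def tail_def)

text \<open>
  The ratio in the hypothesis of regular variation at \<open>t = 1\<close> is \<open>1\<close>, or \<open>0 / 0 = 0\<close> when
  the tail vanishes; since it tends to \<open>1\<close>, the decreasing tail never vanishes.
\<close>

lemma tail_t0_pos: "tail t0 z > 0"
proof -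
  have "\<forall>\<^sub>F z in at_top. tail t0 (z * 1) / tail t0 z > 0"
    using order_tendstoD(1)[OF X_t0_regularly_varying[of 1], of 0] unfolding tail_def by simp
  then obtain z' where "z' \<ge> z" "tail t0 z' / tail t0 z' > 0"
    unfolding eventually_at_top_linorder by (metis linorder_linear mult.right_neutral)
  then have "tail t0 z' > 0" by (metis divide_eq_0_iff measure_nonneg less_le tail_def)
  also have "tail t0 z' \<le> tail t0 z"
    unfolding tail_def using \<open>z' \<ge> z\<close> t0 by (intro finite_measure_mono nrm_X_sets) auto
  finally show ?thesis .
qed

lemma scaling_pos: "scaling z > 0"
  using p_t0 tail_t0_pos by (simp add: scaling_def)

lemma scaling_tail_tendsto:
  assumes "h \<in> Q"
  shows "((\<lambda>z. scaling z * tail h z) \<longlongrightarrow> p h) at_top"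
proof -
  have "((\<lambda>z. p t0 * (tail h z / tail t0 z)) \<longlongrightarrow> p t0 * (p h / p t0)) at_top"
    using tail_ratio[OF assms] unfolding tail_def by (rule tendsto_mult[OF tendsto_const])
  then show ?thesis
    using p_t0 by (simp add: scaling_def)
qed

lemma emeasure_level:
  assumes h: "h \<in> Q"
  shows "emeasure \<nu> {f. nrm h f > 1} = ennreal (p h)"
proof -
  have "emeasure M {\<omega>\<in>space M. nrm h (Y h \<omega>) > 1} = 1"
    using Y_exceeds[OF h] by (simp add: emeasure_eq_measure)
  then show ?thesis
    using \<nu>_level[OF h, of 1 "{f. nrm h f > 1}"] h by (simp add: act_one nrm_sets)
qed

text \<open>
  Evaluates the gluing formula at level \<open>1\<close>: restricted to exceedances at \<open>h\<close>, the limit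
  measure is \<open>p h\<close> times the law of \<open>Y h\<close>.
\<close>

lemma density_level:
  assumes h: "h \<in> Q"
  shows "density \<nu> (indicator {f. nrm h f > 1}) = scale_measure (ennreal (p h)) (distr M borel (Y h))"
proof (rule measure_eqI)
  fix A assume "A \<in> sets (density \<nu> (indicator {f. nrm h f > 1}))"
  then have A: "A \<in> sets borel" by (simp add: sets_\<nu>)
  have "AE \<omega> in M. nrm h (Y h \<omega>) > 1"
    using Y_exceeds[OF h] measurable_sets[OF Y_random[OF h] nrm_sets[OF h, of 1]]
    by (subst (asm) prob_eq_1) (auto simp: vimage_def Int_def conj_commute)
  then have "emeasure M {\<omega>\<in>space M. Y h \<omega> \<in> A \<inter> {f. nrm h f > 1}} = emeasure M {\<omega>\<in>space M. Y h \<omega> \<in> A}"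
    using A nrm_sets[OF h]
    by (intro emeasure_eq_AE random_sets[OF Y_random[OF h]]) auto
  moreover have "emeasure (density \<nu> (indicator {f. nrm h f > 1})) A = emeasure \<nu> (A \<inter> {f. nrm h f > 1})"
    using A h by (subst emeasure_density)
      (auto simp: sets_\<nu> measurable_\<nu> nrm_sets nn_integral_indicator[symmetric] simp del: nn_integral_indicator
        intro!: nn_integral_cong split: split_indicator)
  moreover have "emeasure \<nu> (A \<inter> {f. nrm h f > 1}) =
      ennreal (p h) * emeasure M {\<omega>\<in>space M. Y h \<omega> \<in> A \<inter> {f. nrm h f > 1}}"
    using \<nu>_level[OF h, of 1 "A \<inter> {f. nrm h f > 1}"] h A by (simp add: act_one nrm_sets)
  ultimately show "emeasure (density \<nu> (indicator {f. nrm h f > 1})) A =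
      emeasure (scale_measure (ennreal (p h)) (distr M borel (Y h))) A"
    using A Y_random[OF h] by (simp add: emeasure_distr vimage_def Int_def conj_commute)
qed (simp add: sets_\<nu>)

lemma integral_level:
  fixes G :: "'d \<Rightarrow> real"
  assumes h: "h \<in> Q" and G: "G \<in> borel_measurable borel"
  shows "(LINT f|\<nu>. G f * indicator {f. nrm h f > 1} f) = p h * integral\<^sup>L (distr M borel (Y h)) G"
proof -
  have "(LINT f|\<nu>. G f * indicator {f. nrm h f > 1} f) = integral\<^sup>L (density \<nu> (indicator {f. nrm h f > 1})) G"
  proof -
    have "density \<nu> (indicator {f. nrm h f > 1}) = density \<nu> (\<lambda>f. ennreal (indicator {f. nrm h f > 1} f))"
      by (simp add: ennreal_indicator)
    then show ?thesis
      using h G by (simp add: integral_density measurable_\<nu> nrm_sets sets_\<nu> mult.commute)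
  qed
  then show ?thesis
    unfolding density_level[OF h] using G p_nonneg[OF h] by (simp add: integral_scale_measure)
qed

text \<open>
  The countably many sets \<open>nrm h f > 1 / Suc k\<close> have finite measure, and what they leave
  uncovered is a null set.
\<close>

lemma sigma_finite_\<nu>: "sigma_finite_measure \<nu>"
proof
  define Z where "Z = {f. \<forall>h\<in>Q. nrm h f \<le> 0}"
  define L where "L h k = {f. nrm h f > 1 / Suc k}" for h and k :: nat
  have Z: "Z \<in> sets borel"
  proof -
    have "Z = UNIV - (\<Union>h\<in>Q. {f. nrm h f > 0})" by (force simp: Z_def)
    moreover have "(\<Union>h\<in>Q. {f. nrm h f > 0}) \<in> sets borel"
      using Q_countable nrm_sets by (intro sets.countable_UN') auto
    ultimately show ?thesis by auto
  qed
  have "emeasure \<nu> Z = 0"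
    using Z nrm_nonneg by (intro \<nu>_off) (auto simp: Z_def intro: antisym)
  moreover have "emeasure \<nu> (L h k) \<noteq> \<infinity>" if "h \<in> Q" for h k
    using \<nu>_level[OF that, of "1 / Suc k" "L h k"] nrm_sets[OF that]
    by (auto simp: L_def ennreal_mult_eq_top_iff)
  moreover have "\<Union> (insert Z ((\<lambda>(h, k). L h k) ` (Q \<times> UNIV))) = UNIV"
  proof -
    have "\<exists>h\<in>Q. \<exists>k. f \<in> L h k" if f: "f \<notin> Z" for f
    proof -
      obtain h where "h \<in> Q" "nrm h f > 0" using f by (force simp: Z_def)
      then show ?thesis using nat_approx_posE[of "nrm h f"] unfolding L_def by blast
    qed
    then show ?thesis by blast
  qed
  ultimately show "\<exists>A. countable A \<and> A \<subseteq> sets \<nu> \<and> \<Union> A = space \<nu> \<and> (\<forall>a\<in>A. emeasure \<nu> a \<noteq> \<infinity>)"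
    using Z Q_countable nrm_sets
    by (intro exI[of _ "insert Z ((\<lambda>(h, k). L h k) ` (Q \<times> UNIV))"])
      (auto simp: sets_\<nu> L_def)
qed

text \<open>
  The expectation on the event \<open>nrm h X > z\<close> factors into the probability of this event and a
  conditional expectation. The normalised probability tends to \<open>p h\<close>; if \<open>p h > 0\<close> the
  conditional expectation converges by the continuous mapping theorem, and if \<open>p h = 0\<close> its
  boundedness suffices.
\<close>

lemma scaled_level_tendsto:
  fixes G :: "'d \<Rightarrow> real"
  assumes h: "h \<in> Q" and G: "G \<in> borel_measurable borel" "\<And>f. \<bar>G f\<bar> \<le> C"
    and cont: "\<And>h. h \<in> Q \<Longrightarrow> AE f in distr M borel (Y h). isCont G f"
  shows "((\<lambda>z. scaling z * expectation (\<lambda>\<omega>. G (scaled z \<omega>) * indicator {f. nrm h f > 1} (scaled z \<omega>)))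
    \<longlongrightarrow> (LINT f|\<nu>. G f * indicator {f. nrm h f > 1} f)) at_top"
proof -
  have C: "C \<ge> 0" using G(2)[of undefined] by simp
  define A where "A z = {\<omega>\<in>space M. nrm h (X \<omega>) > z}" for z
  have A: "A z \<in> events" for z using h nrm_X_sets by (simp add: A_def)
  have tail_A: "tail h z = prob (A z)" for z by (simp add: tail_def A_def)
  define e where "e z = expectation (\<lambda>\<omega>. G (scaled z \<omega>) * indicator (A z) \<omega>)" for z
  have e: "expectation (\<lambda>\<omega>. G (scaled z \<omega>) * indicator {f. nrm h f > 1} (scaled z \<omega>)) = e z"
    if "z > 0" for z
    unfolding e_def using that
    by (intro Bochner_Integration.integral_cong) (auto simp: A_def nrm_scaled[OF that h] split: split_indicator)
  have G_scaled: "(\<lambda>\<omega>. G (scaled z \<omega>)) \<in> borel_measurable M" if "z > 0" for z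
    using measurable_compose[OF scaled_random[OF that] G(1)] .
  have "((\<lambda>z. scaling z * e z) \<longlongrightarrow> (LINT f|\<nu>. G f * indicator {f. nrm h f > 1} f)) at_top"
  proof (cases "p h = 0")
    case True
    have "((\<lambda>z. scaling z * tail h z * C) \<longlongrightarrow> 0 * C) at_top"
      using tendsto_mult[OF scaling_tail_tendsto[OF h] tendsto_const[of C]] True by simp
    moreover have "\<forall>\<^sub>F z in at_top. norm (scaling z * e z) \<le> scaling z * tail h z * C"
      using eventually_gt_at_top[of 0]
    proof eventually_elim
      case (elim z)
      have int: "integrable M (\<lambda>\<omega>. G (scaled z \<omega>) * indicator (A z) \<omega>)"
        using A G_scaled[OF elim] G(2)
        by (intro integrable_real_mult_indicator integrable_const_bound[of _ C]) auto
      have "\<bar>e z\<bar> \<le> expectation (\<lambda>\<omega>. \<bar>G (scaled z \<omega>) * indicator (A z) \<omega>\<bar>)"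
        unfolding e_def by (rule integral_abs_bound)
      also have "\<dots> \<le> expectation (\<lambda>\<omega>. C * indicator (A z) \<omega>)"
        using A G(2) by (intro integral_mono integrable_abs int)
          (simp_all add: less_top[symmetric] C split: split_indicator)
      also have "\<dots> = tail h z * C" using A by (simp add: tail_A)
      finally have "scaling z * \<bar>e z\<bar> \<le> scaling z * (tail h z * C)"
        using scaling_nonneg by (rule mult_left_mono)
      then show ?case
        unfolding real_norm_def abs_mult abs_of_nonneg[OF scaling_nonneg] mult.assoc .
    qed
    ultimately have "((\<lambda>z. scaling z * e z) \<longlongrightarrow> 0) at_top"
      unfolding mult_zero_left by (rule Lim_null_comparison[rotated])
    then show ?thesis using integral_level[OF h G(1)] True by simp
  next
    case False
    then have ph: "p h > 0" using p_nonneg[OF h] by simp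
    define \<mu> where "\<mu> = conditional_scaled_law act nrm M X h"
    have \<mu>_eq: "\<mu> z = distr (uniform_measure M (A z)) borel (scaled z)" for z
      unfolding \<mu>_def conditional_scaled_law_def A_def scaled_def ..
    have prob_A: "prob (A z) > 0" if "scaling z * tail h z > 0" for z
      using that scaling_pos[of z] unfolding tail_A by (rule zero_less_mult_pos)
    have pos: "\<forall>\<^sub>F z in at_top. scaling z * tail h z > 0"
      using order_tendstoD(1)[OF scaling_tail_tendsto[OF h] ph] .
    have "((\<lambda>z. integral\<^sup>L (\<mu> z) G) \<longlongrightarrow> integral\<^sup>L (distr M borel (Y h)) G) at_top"
    proof (rule weakly_converges_AE_continuous)
      show "weakly_converges \<mu> (distr M borel (Y h)) at_top"
        unfolding \<mu>_def by (rule conditional_limit[OF h ph])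
      show "\<forall>\<^sub>F z in at_top. prob_space (\<mu> z) \<and> sets (\<mu> z) = sets borel"
        using pos eventually_gt_at_top[of 0]
      proof eventually_elim
        case (elim z)
        then have "prob_space (uniform_measure M (A z))"
          using prob_A[of z] by (intro prob_space_uniform_measure) (simp_all add: emeasure_eq_measure)
        moreover have "scaled z \<in> uniform_measure M (A z) \<rightarrow>\<^sub>M borel"
          using scaled_random[OF elim(2)] by (simp cong: measurable_cong_sets)
        ultimately show ?case
          unfolding \<mu>_eq by (simp add: prob_space.prob_space_distr)
      qed
      show "prob_space (distr M borel (Y h))"
        by (rule prob_space_distr[OF Y_random[OF h]])
    qed (use G cont h in auto)
    from tendsto_mult[OF scaling_tail_tendsto[OF h] this]
    have "((\<lambda>z. scaling z * tail h z * integral\<^sup>L (\<mu> z) G) \<longlongrightarrow>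
        (LINT f|\<nu>. G f * indicator {f. nrm h f > 1} f)) at_top"
      by (simp add: integral_level[OF h G(1)])
    moreover have "\<forall>\<^sub>F z in at_top. scaling z * tail h z * integral\<^sup>L (\<mu> z) G = scaling z * e z"
      using pos eventually_gt_at_top[of 0]
    proof eventually_elim
      case (elim z)
      have "integral\<^sup>L (\<mu> z) G = integral\<^sup>L (uniform_measure M (A z)) (\<lambda>\<omega>. G (scaled z \<omega>))"
        unfolding \<mu>_eq using scaled_random[OF elim(2)] G(1)
        by (intro integral_distr) (simp_all cong: measurable_cong_sets)
      then show ?case
        unfolding e_def tail_A mult.assoc
        using integral_uniform_measure[OF A prob_A[OF elim(1)] G_scaled[OF elim(2)]] by simp
    qed
    ultimately show ?thesis by (rule Lim_transform_eventually)
  qed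
  moreover have "\<forall>\<^sub>F z in at_top. scaling z * e z =
      scaling z * expectation (\<lambda>\<omega>. G (scaled z \<omega>) * indicator {f. nrm h f > 1} (scaled z \<omega>))"
    using eventually_gt_at_top[of 0] by eventually_elim (simp add: e)
  ultimately show ?thesis by (rule Lim_transform_eventually)
qed

section \<open>Sums over all exceedance events\<close>

lemma q_nonneg: "K \<in> range KQ \<Longrightarrow> t \<in> K \<Longrightarrow> q t \<ge> 0"
  using q_pos[of t] KQ_subset by (auto intro: less_imp_le)

lemma weights_integrable:
  assumes K: "K \<in> range KQ"
  shows "integrable (count_space K) (\<lambda>t. max 1 (p t) * q t)"
    and "integrable (count_space K) q"
    and "integrable (count_space K) (\<lambda>t. p t * q t)"
proof -
  have KQ: "K \<subseteq> Q" using K KQ_subset by blast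
  have "(\<lambda>t. max 1 (p t) * q t) summable_on K"
    using q_summable KQ by (rule summable_on_subset_banach)
  moreover have "norm (max 1 (p t) * q t) = max 1 (p t) * q t" if "t \<in> K" for t
    using q_pos[of t] that KQ by (auto simp: abs_mult max_def)
  ultimately have "(\<lambda>t. norm (max 1 (p t) * q t)) summable_on K"
    using summable_on_cong by (metis (mono_tags, lifting))
  then show *: "integrable (count_space K) (\<lambda>t. max 1 (p t) * q t)"
    using abs_summable_equivalent unfolding Infinite_Set_Sum.abs_summable_on_def by blast
  have le: "\<bar>s * q t\<bar> \<le> \<bar>max 1 (p t) * q t\<bar>" if "t \<in> K" "0 \<le> s" "s \<le> max 1 (p t)" for s t
    using that q_pos[of t] KQ by (auto simp: abs_mult intro!: mult_right_mono)
  show "integrable (count_space K) q"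
    by (rule Bochner_Integration.integrable_bound[OF *]) (use le[of _ 1] in \<open>auto intro!: AE_I2\<close>)
  show "integrable (count_space K) (\<lambda>t. p t * q t)"
    by (rule Bochner_Integration.integrable_bound[OF *])
      (use le[of _ "p _"] p_nonneg KQ in \<open>auto intro!: AE_I2\<close>)
qed

lemma exceedance_eq: "K \<in> range KQ \<Longrightarrow> exceedance nrm q K f = ennreal (E K f)"
  by (intro exceedance_eq_real_exceedance weights_integrable(2) q_nonneg)

lemma E_nonneg: "K \<in> range KQ \<Longrightarrow> E K f \<ge> 0"
  unfolding real_exceedance_def
  by (intro integral_nonneg_AE AE_I2) (simp add: q_nonneg split: split_indicator)

lemma E_measurable: "K \<in> range KQ \<Longrightarrow> E K \<in> borel_measurable borel"
  using KQ_subset by (intro real_exceedance_measurable) auto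

lemma E_pos_iff:
  assumes K: "K \<in> range KQ"
  shows "E K f > 0 \<longleftrightarrow> (\<exists>t\<in>K. nrm t f > 1)"
proof -
  have KQ: "K \<subseteq> Q" using K KQ_subset by blast
  have int: "integrable (count_space K) (\<lambda>t. q t * indicator {g. nrm t g > 1} f)"
    by (rule Bochner_Integration.integrable_bound[OF weights_integrable(2)[OF K]])
      (auto intro!: AE_I2 split: split_indicator)
  have "E K f = 0 \<longleftrightarrow> (AE t in count_space K. q t * indicator {g. nrm t g > 1} f = 0)"
    unfolding real_exceedance_def
    by (intro integral_nonneg_eq_0_iff_AE int AE_I2) (simp add: q_nonneg[OF K] split: split_indicator)
  also have "\<dots> \<longleftrightarrow> (\<forall>t\<in>K. \<not> nrm t f > 1)"
  proof -
    have "q t \<noteq> 0" if "t \<in> K" for t using q_pos[of t] that KQ by auto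
    then show ?thesis by (simp add: AE_count_space indicator_def)
  qed
  finally show ?thesis using E_nonneg[OF K, of f] by auto
qed

lemma E_pos_iff_nrm_sup: "K \<in> range KQ \<Longrightarrow> E K f > 0 \<longleftrightarrow> nrm_sup nrm Q K f > 1"
  using less_nrm_sup_iff[of 1 K f] KQ_subset by (auto simp: E_pos_iff)

lemma AE_isCont_E:
  assumes "h \<in> Q" "K \<in> range KQ"
  shows "AE f in distr M borel (Y h). isCont (E K) f"
  using exceedance_continuous[OF assms]
proof eventually_elim
  case (elim f)
  then have "(exceedance nrm q K \<longlongrightarrow> ennreal (E K f)) (at f)"
    by (simp add: isCont_def exceedance_eq[OF assms(2)])
  then have "((\<lambda>x. enn2real (exceedance nrm q K x)) \<longlongrightarrow> E K f) (at f)"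
    using E_nonneg[OF assms(2)] by (rule tendsto_enn2real)
  then show ?case
    using E_nonneg[OF assms(2)] by (simp add: isCont_def exceedance_eq[OF assms(2)])
qed

lemma scaled_nrm_sup_bounded:
  assumes K: "K \<in> range KQ"
  obtains L where "L \<ge> 0"
    and "\<forall>\<^sub>F z in at_top. scaling z * prob {\<omega>\<in>space M. nrm_sup nrm Q K (X \<omega>) > ennreal z} \<le> L"
proof -
  let ?r = "\<lambda>z. prob {\<omega>\<in>space M. nrm_sup nrm Q K (X \<omega>) > ennreal z} / tail t0 z"
  have "Limsup at_top (\<lambda>z. ereal (?r z)) < \<infinity>"
    using limsup_finite[OF _ K, of 1] by (simp add: tail_def)
  then obtain L where "Limsup at_top (\<lambda>z. ereal (?r z)) < ereal L"
    using ereal_dense2 by blast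
  then have "\<forall>\<^sub>F z in at_top. ereal (?r z) < ereal L"
    by (rule Limsup_lessD)
  then have "\<forall>\<^sub>F z in at_top. scaling z * prob {\<omega>\<in>space M. nrm_sup nrm Q K (X \<omega>) > ennreal z} \<le> p t0 * \<bar>L\<bar>"
  proof eventually_elim
    case (elim z)
    then have "?r z \<le> \<bar>L\<bar>" by simp
    then have "p t0 * ?r z \<le> p t0 * \<bar>L\<bar>"
      using less_imp_le[OF p_t0] by (rule mult_left_mono)
    then show ?case by (simp add: scaling_def)
  qed
  moreover have "p t0 * \<bar>L\<bar> \<ge> 0" using p_t0 by simp
  ultimately show thesis by (rule that[rotated])
qed

lemma nrm_sup_X_sets: "r \<ge> 0 \<Longrightarrow> {\<omega>\<in>space M. nrm_sup nrm Q K (X \<omega>) > ennreal r} \<in> events"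
  using random_sets[OF X_random nrm_sup_sets[of r K]] by simp

text \<open>
  The interchange of sum and integral that turns the factor \<open>E K\<close> into single exceedance
  events. It is used for the limit measure with \<open>b = p\<close> and for the law of the rescaled \<open>X\<close> with
  \<open>b = 1\<close>, which is where the summability of \<open>max 1 (p t) * q t\<close> enters.
\<close>

lemma exceedance_expansion:
  assumes K: "K \<in> range KQ" and N: "sigma_finite_measure N"
    and Z: "Z \<in> N \<rightarrow>\<^sub>M borel" and G: "G \<in> borel_measurable borel" "\<And>f. \<bar>G f\<bar> \<le> C"
    and level: "\<And>t. t \<in> K \<Longrightarrow> emeasure N {x\<in>space N. nrm t (Z x) > 1} \<le> ennreal (b t)"
    and b: "integrable (count_space K) (\<lambda>t. b t * q t)" "\<And>t. t \<in> K \<Longrightarrow> b t \<ge> 0"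
  shows "integrable N (\<lambda>x. G (Z x) * E K (Z x))"
    and "(LINT x|N. G (Z x) * E K (Z x)) =
      (LINT t|count_space K. q t * (LINT x|N. G (Z x) * indicator {f. nrm t f > 1} (Z x)))"
proof -
  have KQ: "K \<subseteq> Q" using K KQ_subset by blast
  then have countable: "countable K" using Q_countable countable_subset by blast
  have C: "C \<ge> 0" using G(2)[of undefined] by simp
  define A where "A t = {x\<in>space N. nrm t (Z x) > 1}" for t
  define F where "F t x = q t * (G (Z x) * indicator {f. nrm t f > 1} (Z x))" for t x
  have A [measurable]: "A t \<in> sets N" if "t \<in> K" for t
    using measurable_sets[OF Z nrm_sets[of t 1]] that KQ by (auto simp: A_def vimage_def Int_def conj_commute)
  have finA: "emeasure N (A t) < \<infinity>" if "t \<in> K" for t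
    using level[OF that] by (simp add: A_def le_less_trans)
  have F_bound: "\<bar>F t x\<bar> \<le> q t * C * indicator (A t) x" if "t \<in> K" "x \<in> space N" for t x
    using q_pos[of t] KQ that G(2)[of "Z x"]
    by (auto simp: F_def A_def abs_mult mult_left_mono split: split_indicator)
  have int_bound: "integrable N (\<lambda>x. q t * C * indicator (A t) x)" if "t \<in> K" for t
    using A finA that by simp
  have F_meas: "F t \<in> borel_measurable N" if "t \<in> K" for t
  proof -
    have [measurable]: "{f. nrm t f > 1} \<in> sets borel" using that KQ nrm_sets by blast
    note Z[measurable] G(1)[measurable]
    show ?thesis unfolding F_def[abs_def] by measurable
  qed
  have F: "integrable N (F t)" if "t \<in> K" for t
    by (rule Bochner_Integration.integrable_bound[OF int_bound[OF that] F_meas[OF that]])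
      (use F_bound[OF that] in \<open>fastforce intro!: AE_I2\<close>)
  have bound: "(LINT x|N. \<bar>F t x\<bar>) \<le> C * (b t * q t)" if "t \<in> K" for t
  proof -
    have "(LINT x|N. \<bar>F t x\<bar>) \<le> (LINT x|N. q t * C * indicator (A t) x)"
      using F_bound that by (intro integral_mono integrable_abs F int_bound) auto
    also have "\<dots> = q t * C * measure N (A t)" using A[OF that] finA[OF that] by simp
    also have "\<dots> \<le> q t * C * b t"
      using level[OF that] b(2)[OF that] q_pos[of t] that KQ C
      by (intro mult_left_mono) (auto simp: A_def measure_def enn2real_leI)
    finally show ?thesis by (simp add: mult_ac)
  qed
  have sum: "(LINT t|count_space K. F t x) = G (Z x) * E K (Z x)" for x
    unfolding F_def real_exceedance_def mult.left_commute[of "q _" "G _"]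
    by (rule integral_mult_right_zero)
  note swap = integral_count_space_swap[OF N countable F bound integrable_mult_right[OF b(1)]]
  show "integrable N (\<lambda>x. G (Z x) * E K (Z x))"
    using swap(1) by (simp add: sum)
  show "(LINT x|N. G (Z x) * E K (Z x)) =
      (LINT t|count_space K. q t * (LINT x|N. G (Z x) * indicator {f. nrm t f > 1} (Z x)))"
    using swap(2) unfolding sum by (simp add: F_def)
qed

lemma exceedance_expansion_\<nu>:
  assumes "K \<in> range KQ" and "G \<in> borel_measurable borel" "\<And>f. \<bar>G f\<bar> \<le> C"
  shows "integrable \<nu> (\<lambda>f. G f * E K f)"
    and "(LINT f|\<nu>. G f * E K f) =
      (LINT t|count_space K. q t * (LINT f|\<nu>. G f * indicator {f. nrm t f > 1} f))"
proof -
  have level: "emeasure \<nu> {f\<in>space \<nu>. nrm t f > 1} \<le> ennreal (p t)" "p t \<ge> 0" if "t \<in> K" for t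
  proof -
    have "t \<in> Q" using that assms(1) KQ_subset by blast
    then show "emeasure \<nu> {f\<in>space \<nu>. nrm t f > 1} \<le> ennreal (p t)" "p t \<ge> 0"
      using emeasure_level[of t] p_nonneg[of t] by simp_all
  qed
  have id: "(\<lambda>f. f) \<in> \<nu> \<rightarrow>\<^sub>M borel" by (simp add: measurable_\<nu>)
  note expansion = exceedance_expansion[OF assms(1) sigma_finite_\<nu> id assms(2,3) level(1)
      weights_integrable(3)[OF assms(1)] level(2)]
  show "integrable \<nu> (\<lambda>f. G f * E K f)"
    by (rule expansion(1))
  show "(LINT f|\<nu>. G f * E K f) =
      (LINT t|count_space K. q t * (LINT f|\<nu>. G f * indicator {f. nrm t f > 1} f))"
    by (rule expansion(2))
qed

lemma exceedance_expansion_scaled: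
  assumes "K \<in> range KQ" and "G \<in> borel_measurable borel" "\<And>f. \<bar>G f\<bar> \<le> C" and "z > 0"
  shows "integrable M (\<lambda>\<omega>. G (scaled z \<omega>) * E K (scaled z \<omega>))"
    and "expectation (\<lambda>\<omega>. G (scaled z \<omega>) * E K (scaled z \<omega>)) =
      (LINT t|count_space K. q t * expectation (\<lambda>\<omega>. G (scaled z \<omega>) * indicator {f. nrm t f > 1} (scaled z \<omega>)))"
proof -
  have b: "integrable (count_space K) (\<lambda>t. 1 * q t)"
    using weights_integrable(2)[OF assms(1)] by simp
  have level: "emeasure M {\<omega>\<in>space M. nrm t (scaled z \<omega>) > 1} \<le> ennreal 1" "(0::real) \<le> 1" for t
    by (simp_all add: emeasure_eq_measure)
  note expansion = exceedance_expansion[OF assms(1) sigma_finite_measure_axioms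
      scaled_random[OF assms(4)] assms(2,3) level(1) b level(2)]
  show "integrable M (\<lambda>\<omega>. G (scaled z \<omega>) * E K (scaled z \<omega>))"
    by (rule expansion(1))
  show "expectation (\<lambda>\<omega>. G (scaled z \<omega>) * E K (scaled z \<omega>)) =
      (LINT t|count_space K. q t * expectation (\<lambda>\<omega>. G (scaled z \<omega>) * indicator {f. nrm t f > 1} (scaled z \<omega>)))"
    by (rule expansion(2))
qed

text \<open>
  Dominated convergence over \<open>t \<in> K\<close>. The \<open>t\<close>-th term is at most \<open>C * q t\<close> times the
  normalised probability of \<open>nrm t X > z\<close>, and this event is contained in the one that the
  supremum over \<open>K\<close> exceeds \<open>z\<close>, whose normalised probability stays bounded uniformly in
  \<open>t\<close>.
\<close>

lemma scaled_exceedance_tendsto: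
  fixes G :: "'d \<Rightarrow> real"
  assumes K: "K \<in> range KQ" and G: "G \<in> borel_measurable borel" "\<And>f. \<bar>G f\<bar> \<le> C"
    and cont: "\<And>h. h \<in> Q \<Longrightarrow> AE f in distr M borel (Y h). isCont G f"
  shows "((\<lambda>z. scaling z * expectation (\<lambda>\<omega>. G (scaled z \<omega>) * E K (scaled z \<omega>)))
    \<longlongrightarrow> (LINT f|\<nu>. G f * E K f)) at_top"
proof -
  have KQ: "K \<subseteq> Q" using K KQ_subset by blast
  have C: "C \<ge> 0" using G(2)[of undefined] by simp
  define a where "a z t = scaling z *
    expectation (\<lambda>\<omega>. G (scaled z \<omega>) * indicator {f. nrm t f > 1} (scaled z \<omega>))" for z t
  define b where "b t = (LINT f|\<nu>. G f * indicator {f. nrm t f > 1} f)" for t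
  obtain L where L: "L \<ge> 0"
    "\<forall>\<^sub>F z in at_top. scaling z * prob {\<omega>\<in>space M. nrm_sup nrm Q K (X \<omega>) > ennreal z} \<le> L"
    using scaled_nrm_sup_bounded[OF K] .
  have "((\<lambda>z. LINT t|count_space K. q t * a z t) \<longlongrightarrow> (LINT t|count_space K. q t * b t)) at_top"
  proof (rule integral_dominated_convergence_at_top[where w="\<lambda>t. C * L * q t"])
    show "integrable (count_space K) (\<lambda>t. C * L * q t)"
      using weights_integrable(2)[OF K] by simp
    show "AE t in count_space K. ((\<lambda>z. q t * a z t) \<longlongrightarrow> q t * b t) at_top"
      unfolding a_def b_def AE_count_space using KQ
      by (intro ballI tendsto_mult tendsto_const scaled_level_tendsto[OF _ G cont]) auto
    show "\<forall>\<^sub>F z in at_top. AE t in count_space K. norm (q t * a z t) \<le> C * L * q t"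
      using L(2) eventually_gt_at_top[of 0]
    proof eventually_elim
      case (elim z)
      have "\<bar>q t * a z t\<bar> \<le> C * L * q t" if t: "t \<in> K" for t
      proof -
        let ?e = "\<lambda>\<omega>. G (scaled z \<omega>) * indicator {f. nrm t f > 1} (scaled z \<omega>)"
        let ?A = "{\<omega>\<in>space M. nrm_sup nrm Q K (X \<omega>) > ennreal z}"
        have A: "?A \<in> events" using elim by (intro nrm_sup_X_sets) simp
        have le: "\<bar>?e \<omega>\<bar> \<le> C * indicator ?A \<omega>" if \<omega>: "\<omega> \<in> space M" for \<omega>
        proof (cases "nrm t (scaled z \<omega>) > 1")
          case True
          then have "nrm t (X \<omega>) > z"
            using elim t KQ by (auto simp: nrm_scaled)
          then have "nrm_sup nrm Q K (X \<omega>) > ennreal z"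
            using elim t KQ by (auto simp: less_nrm_sup_iff)
          then show ?thesis using True G(2) \<omega> by simp
        qed (use C in simp)
        have "\<bar>expectation ?e\<bar> \<le> expectation (\<lambda>\<omega>. \<bar>?e \<omega>\<bar>)"
          by (rule integral_abs_bound)
        also have "\<dots> \<le> expectation (\<lambda>\<omega>. C * indicator ?A \<omega>)"
          by (rule integral_mono') (use le A C in \<open>auto simp: less_top[symmetric]\<close>)
        also have "\<dots> = C * prob ?A" using A by simp
        finally have "scaling z * \<bar>expectation ?e\<bar> \<le> scaling z * (C * prob ?A)"
          using scaling_nonneg by (rule mult_left_mono)
        also have "\<dots> = C * (scaling z * prob ?A)" by simp
        also have "\<dots> \<le> C * L" using elim(1) C by (rule mult_left_mono)
        finally have "\<bar>a z t\<bar> \<le> C * L"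
          unfolding a_def abs_mult abs_of_nonneg[OF scaling_nonneg] .
        then have "q t * \<bar>a z t\<bar> \<le> q t * (C * L)"
          using q_pos[of t] t KQ by (intro mult_left_mono) auto
        then show ?thesis
          using q_pos[of t] t KQ by (auto simp: abs_mult mult_ac)
      qed
      then show ?case by (simp add: AE_count_space)
    qed
  qed auto
  moreover have "\<forall>\<^sub>F z in at_top. (LINT t|count_space K. q t * a z t) =
      scaling z * expectation (\<lambda>\<omega>. G (scaled z \<omega>) * E K (scaled z \<omega>))"
    using eventually_gt_at_top[of 0]
  proof eventually_elim
    case (elim z)
    show ?case
      unfolding exceedance_expansion_scaled(2)[OF K G elim] a_def mult.left_commute[of "q _" "scaling z"]
      by (rule integral_mult_right_zero)
  qed
  ultimately show ?thesis
    unfolding exceedance_expansion_\<nu>(2)[OF K G] b_def by (rule Lim_transform_eventually)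
qed

section \<open>Damped test functions and finiteness of the limit measure\<close>

text \<open>
  The sum of the functionals of the sets \<open>KQ n\<close> rather than the functional of their union:
  almost sure continuity is inherited by sums, whereas continuity of the functionals of two sets
  does not pass to that of their union, because jumps of individual summands may cancel.
\<close>

definition exceedance_sum :: "nat set \<Rightarrow> 'd \<Rightarrow> real" where
  "exceedance_sum I f = (\<Sum>n\<in>I. E (KQ n) f)"

text \<open>
  A bounded substitute for the indicator of \<open>exceedance_sum I f > 0\<close>. It still contains
  \<open>exceedance_sum I f\<close> as a factor, and the cofactor \<open>1 / max (exceedance_sum I f) \<eta>\<close> is
  bounded by \<open>1 / \<eta>\<close> and continuous wherever the sum is.
\<close>

definition damping :: "nat set \<Rightarrow> real \<Rightarrow> 'd \<Rightarrow> real" where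
  "damping I \<eta> f = exceedance_sum I f / max (exceedance_sum I f) \<eta>"

lemma exceedance_sum_measurable: "exceedance_sum I \<in> borel_measurable borel"
  unfolding exceedance_sum_def[abs_def] by (intro borel_measurable_sum E_measurable) auto

lemma exceedance_sum_nonneg: "exceedance_sum I f \<ge> 0"
  unfolding exceedance_sum_def by (intro sum_nonneg E_nonneg) auto

lemma exceedance_sum_ge: "finite I \<Longrightarrow> n \<in> I \<Longrightarrow> E (KQ n) f \<le> exceedance_sum I f"
  unfolding exceedance_sum_def using E_nonneg by (intro member_le_sum) auto

lemma exceedance_sum_pos_iff:
  assumes "finite I"
  shows "exceedance_sum I f > 0 \<longleftrightarrow> (\<exists>n\<in>I. nrm_sup nrm Q (KQ n) f > 1)"
proof -
  have "exceedance_sum I f > 0 \<longleftrightarrow> (\<exists>n\<in>I. E (KQ n) f > 0)"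
    using sum_nonneg_eq_0_iff[OF assms, of "\<lambda>n. E (KQ n) f"] E_nonneg[of "KQ _" f] exceedance_sum_nonneg[of I f]
    unfolding exceedance_sum_def by (metis less_le rangeI)
  then show ?thesis by (simp add: E_pos_iff_nrm_sup)
qed

lemma AE_isCont_exceedance_sum:
  assumes "h \<in> Q" "finite I"
  shows "AE f in distr M borel (Y h). isCont (exceedance_sum I) f"
proof -
  have "AE f in distr M borel (Y h). \<forall>n\<in>I. isCont (E (KQ n)) f"
    using assms AE_isCont_E by (intro AE_finite_allI) auto
  then show ?thesis
    unfolding exceedance_sum_def[abs_def] by eventually_elim (intro continuous_sum, simp)
qed

lemma damping_bounds:
  assumes "\<eta> > 0"
  shows "0 \<le> damping I \<eta> f" "damping I \<eta> f \<le> 1"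
  using assms exceedance_sum_nonneg[of I f] by (auto simp: damping_def divide_le_eq_1)

lemma damping_eq_1: "\<eta> > 0 \<Longrightarrow> exceedance_sum I f \<ge> \<eta> \<Longrightarrow> damping I \<eta> f = 1"
  by (simp add: damping_def)

lemma damping_measurable: "damping I \<eta> \<in> borel_measurable borel"
  unfolding damping_def[abs_def] using exceedance_sum_measurable by measurable

text \<open>
  With \<open>G = H / max (exceedance_sum I) \<eta>\<close>, the damped function is the finite sum of the
  products \<open>G * E (KQ n)\<close>, each covered by the limit theorem for sums over exceedance events.
\<close>

lemma damped_tendsto:
  fixes H :: "'d \<Rightarrow> real"
  assumes I: "finite I" and \<eta>: "\<eta> > 0"
    and H: "continuous_on UNIV H" "\<And>f. \<bar>H f\<bar> \<le> C"
  shows "integrable \<nu> (\<lambda>f. H f * damping I \<eta> f)"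
    and "((\<lambda>z. scaling z * expectation (\<lambda>\<omega>. H (scaled z \<omega>) * damping I \<eta> (scaled z \<omega>)))
      \<longlongrightarrow> (LINT f|\<nu>. H f * damping I \<eta> f)) at_top"
proof -
  define G where "G f = H f / max (exceedance_sum I f) \<eta>" for f
  have pos: "max (exceedance_sum I f) \<eta> > 0" for f using \<eta> by (simp add: less_max_iff_disj)
  have C: "C \<ge> 0" using H(2)[of undefined] by simp
  have H_meas: "H \<in> borel_measurable borel" using H(1) by (rule borel_measurable_continuous_onI)
  have G_meas: "G \<in> borel_measurable borel"
    unfolding G_def[abs_def] using H_meas exceedance_sum_measurable[of I] by measurable
  have G_bound: "\<bar>G f\<bar> \<le> C / \<eta>" for f
    unfolding G_def abs_divide abs_of_pos[OF pos] using H(2)[of f] C \<eta>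
    by (intro frac_le) auto
  have G_cont: "AE f in distr M borel (Y h). isCont G f" if "h \<in> Q" for h
    using AE_isCont_exceedance_sum[OF that I]
  proof eventually_elim
    case (elim f)
    have "isCont H f" using H(1) by (simp add: continuous_on_eq_continuous_at)
    moreover have "max (exceedance_sum I f) \<eta> \<noteq> 0" using pos[of f] by simp
    ultimately show ?case
      unfolding G_def[abs_def] using elim by (intro continuous_intros)
  qed
  have split: "H f * damping I \<eta> f = (\<Sum>n\<in>I. G f * E (KQ n) f)" for f
    by (simp add: G_def damping_def exceedance_sum_def sum_distrib_left sum_divide_distrib)
  have KQ: "KQ n \<in> range KQ" for n by simp
  show "integrable \<nu> (\<lambda>f. H f * damping I \<eta> f)"
    unfolding split by (intro Bochner_Integration.integrable_sum exceedance_expansion_\<nu>(1)[OF KQ G_meas G_bound])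
  have "((\<lambda>z. \<Sum>n\<in>I. scaling z * expectation (\<lambda>\<omega>. G (scaled z \<omega>) * E (KQ n) (scaled z \<omega>)))
      \<longlongrightarrow> (\<Sum>n\<in>I. LINT f|\<nu>. G f * E (KQ n) f)) at_top"
    by (intro tendsto_sum scaled_exceedance_tendsto[OF KQ G_meas G_bound G_cont])
  moreover have "(\<Sum>n\<in>I. LINT f|\<nu>. G f * E (KQ n) f) = (LINT f|\<nu>. H f * damping I \<eta> f)"
    unfolding split
    by (intro Bochner_Integration.integral_sum[symmetric] exceedance_expansion_\<nu>(1)[OF KQ G_meas G_bound])
  moreover have "\<forall>\<^sub>F z in at_top.
      (\<Sum>n\<in>I. scaling z * expectation (\<lambda>\<omega>. G (scaled z \<omega>) * E (KQ n) (scaled z \<omega>))) =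
      scaling z * expectation (\<lambda>\<omega>. H (scaled z \<omega>) * damping I \<eta> (scaled z \<omega>))"
    using eventually_gt_at_top[of 0]
  proof eventually_elim
    case (elim z)
    have "expectation (\<lambda>\<omega>. \<Sum>n\<in>I. G (scaled z \<omega>) * E (KQ n) (scaled z \<omega>)) =
        (\<Sum>n\<in>I. expectation (\<lambda>\<omega>. G (scaled z \<omega>) * E (KQ n) (scaled z \<omega>)))"
      by (rule Bochner_Integration.integral_sum)
        (rule exceedance_expansion_scaled(1)[OF KQ G_meas G_bound elim])
    then show ?case
      unfolding split by (simp only: sum_distrib_left)
  qed
  ultimately show "((\<lambda>z. scaling z * expectation (\<lambda>\<omega>. H (scaled z \<omega>) * damping I \<eta> (scaled z \<omega>)))
      \<longlongrightarrow> (LINT f|\<nu>. H f * damping I \<eta> f)) at_top"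
    using Lim_transform_eventually by fastforce
qed

text \<open>
  For every \<open>\<eta>\<close>, the integral of the damping factor is the limit of quantities bounded by the
  normalised tail of the supremum, because the damping factor vanishes unless the supremum of the
  rescaled \<open>X\<close> exceeds \<open>1\<close>. The resulting bound \<open>L\<close> does not depend on \<open>\<eta>\<close>, and Markov's
  inequality carries it to the sets \<open>exceedance_sum {n} f \<ge> \<eta>\<close>, which increase to the set in
  question.
\<close>

lemma emeasure_nrm_sup_finite:
  "emeasure \<nu> {f. nrm_sup nrm Q (KQ n) f > 1} < \<infinity>"
proof -
  obtain L where L: "L \<ge> 0"
    "\<forall>\<^sub>F z in at_top. scaling z * prob {\<omega>\<in>space M. nrm_sup nrm Q (KQ n) (X \<omega>) > ennreal z} \<le> L"
    using scaled_nrm_sup_bounded[of "KQ n"] by blast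
  have integral_le: "(LINT f|\<nu>. damping {n} \<eta> f) \<le> L" if \<eta>: "\<eta> > 0" for \<eta>
  proof (rule tendsto_upperbound)
    show "((\<lambda>z. scaling z * expectation (\<lambda>\<omega>. damping {n} \<eta> (scaled z \<omega>)))
        \<longlongrightarrow> (LINT f|\<nu>. damping {n} \<eta> f)) at_top"
      using damped_tendsto(2)[of "{n}" \<eta> "\<lambda>_. 1" 1] \<eta> by simp
    show "\<forall>\<^sub>F z in at_top. scaling z * expectation (\<lambda>\<omega>. damping {n} \<eta> (scaled z \<omega>)) \<le> L"
      using L(2) eventually_gt_at_top[of 0]
    proof eventually_elim
      case (elim z)
      let ?A = "{\<omega>\<in>space M. nrm_sup nrm Q (KQ n) (X \<omega>) > ennreal z}"
      have A: "?A \<in> events" using elim by (intro nrm_sup_X_sets) simp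
      have "damping {n} \<eta> (scaled z \<omega>) \<le> indicator ?A \<omega>" if \<omega>: "\<omega> \<in> space M" for \<omega>
      proof (cases "\<omega> \<in> ?A")
        case True
        then show ?thesis using damping_bounds(2)[OF \<eta>] by simp
      next
        case False
        then have "\<not> nrm_sup nrm Q (KQ n) (scaled z \<omega>) > 1"
          using \<omega> elim less_nrm_sup_iff[of 1 "KQ n" "scaled z \<omega>"] less_nrm_sup_iff[of z "KQ n" "X \<omega>"]
          by (auto simp: nrm_scaled)
        then have "exceedance_sum {n} (scaled z \<omega>) = 0"
          using exceedance_sum_pos_iff[of "{n}" "scaled z \<omega>"] exceedance_sum_nonneg[of "{n}" "scaled z \<omega>"] by simp
        then show ?thesis using False by (simp add: damping_def)
      qed
      then have "expectation (\<lambda>\<omega>. damping {n} \<eta> (scaled z \<omega>)) \<le> expectation (\<lambda>\<omega>. indicator ?A \<omega> :: real)"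
        using A by (intro integral_mono') (auto simp: less_top[symmetric])
      then have "scaling z * expectation (\<lambda>\<omega>. damping {n} \<eta> (scaled z \<omega>)) \<le> scaling z * prob ?A"
        using A scaling_nonneg[of z] by (intro mult_left_mono) auto
      with elim show ?case by linarith
    qed
  qed simp
  define S where "S m = {f. exceedance_sum {n} f \<ge> 1 / Suc m}" for m
  have S [measurable]: "S m \<in> sets \<nu>" for m
    unfolding S_def sets_\<nu> using exceedance_sum_measurable[of "{n}"] by measurable
  have S_le: "emeasure \<nu> (S m) \<le> ennreal L" for m
  proof -
    have pos: "1 / Suc m > (0::real)" by simp
    have "emeasure \<nu> (S m) = (\<integral>\<^sup>+f. indicator (S m) f \<partial>\<nu>)"
      using S by simp
    also have "\<dots> \<le> (\<integral>\<^sup>+f. ennreal (damping {n} (1 / Suc m) f) \<partial>\<nu>)"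
      using damping_eq_1[OF pos, of "{n}"]
      by (intro nn_integral_mono) (auto simp: S_def split: split_indicator)
    also have "\<dots> = ennreal (LINT f|\<nu>. damping {n} (1 / Suc m) f)"
      using damped_tendsto(1)[of "{n}" "1 / Suc m" "\<lambda>_. 1" 1] damping_bounds(1)[OF pos]
      by (intro nn_integral_eq_integral) auto
    also have "\<dots> \<le> ennreal L"
      using integral_le[OF pos] by (rule ennreal_leI)
    finally show ?thesis .
  qed
  have "incseq S"
    by (force simp: incseq_def S_def frac_le intro: order_trans[rotated])
  then have "(SUP m. emeasure \<nu> (S m)) = emeasure \<nu> (\<Union>m. S m)"
    using S by (intro SUP_emeasure_incseq) auto
  moreover have "(\<Union>m. S m) = {f. nrm_sup nrm Q (KQ n) f > 1}"
  proof -
    have "(\<exists>m. f \<in> S m) \<longleftrightarrow> exceedance_sum {n} f > 0" for f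
    proof
      assume "\<exists>m. f \<in> S m"
      then obtain m where "1 / Suc m \<le> exceedance_sum {n} f" by (auto simp: S_def)
      moreover have "1 / Suc m > (0::real)" by simp
      ultimately show "exceedance_sum {n} f > 0" by linarith
    next
      assume "exceedance_sum {n} f > 0"
      then obtain m where "1 / Suc m < exceedance_sum {n} f" using nat_approx_posE by blast
      then show "\<exists>m. f \<in> S m" by (auto simp: S_def intro: less_imp_le)
    qed
    then show ?thesis using exceedance_sum_pos_iff[of "{n}"] by auto
  qed
  ultimately have "emeasure \<nu> {f. nrm_sup nrm Q (KQ n) f > 1} \<le> ennreal L"
    using S_le by (metis (mono_tags, lifting) SUP_least)
  then show ?thesis by (simp add: le_less_trans)
qed

section \<open>Removing the damping\<close>

text \<open>
  The damping factor is eventually \<open>1\<close> wherever \<open>H \<noteq> 0\<close>, and the support of \<open>H\<close> lies in a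
  set of finite measure.
\<close>

lemma damping_integral_tendsto:
  fixes H :: "'d \<Rightarrow> real"
  assumes I: "finite I"
    and H: "continuous_on UNIV H" "\<And>f. \<bar>H f\<bar> \<le> C"
    and supp: "\<And>f. H f \<noteq> 0 \<Longrightarrow> \<exists>n\<in>I. nrm_sup nrm Q (KQ n) f > 1"
  shows "(\<lambda>m. LINT f|\<nu>. H f * damping I (1 / Suc m) f) \<longlonglongrightarrow> integral\<^sup>L \<nu> H"
proof -
  have H_meas: "H \<in> borel_measurable borel" using H(1) by (rule borel_measurable_continuous_onI)
  define S where "S = (\<Union>n\<in>I. {f. nrm_sup nrm Q (KQ n) f > 1})"
  have S_sets: "{f. nrm_sup nrm Q (KQ n) f > 1} \<in> sets \<nu>" for n
    using nrm_sup_sets[of 1 "KQ n"] by (simp add: sets_\<nu>)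
  have S: "S \<in> sets \<nu>" using I S_sets by (auto simp: S_def)
  have "emeasure \<nu> S \<le> (\<Sum>n\<in>I. emeasure \<nu> {f. nrm_sup nrm Q (KQ n) f > 1})"
    unfolding S_def using I S_sets by (intro emeasure_subadditive_finite) auto
  also have "\<dots> < \<infinity>" using emeasure_nrm_sup_finite I by (simp add: less_top[symmetric])
  finally have S_fin: "emeasure \<nu> S < \<infinity>" .
  have off: "H f = 0" if "f \<notin> S" for f using supp[of f] that by (auto simp: S_def)
  have C: "C \<ge> 0" using H(2)[of undefined] by simp
  have pos: "1 / Suc m > (0::real)" for m by simp
  show ?thesis
  proof (rule integral_dominated_convergence[where w="\<lambda>f. C * indicator S f"])
    show "integrable \<nu> (\<lambda>f. C * indicator S f)" using S S_fin by simp
    show "AE f in \<nu>. norm (H f * damping I (1 / Suc m) f) \<le> C * indicator S f" for m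
    proof (rule AE_I2)
      fix f
      have "\<bar>H f\<bar> * damping I (1 / Suc m) f \<le> C * 1"
        using H(2)[of f] damping_bounds[OF pos, of I m f] C by (intro mult_mono) auto
      then show "norm (H f * damping I (1 / Suc m) f) \<le> C * indicator S f"
        using off[of f] damping_bounds(1)[OF pos, of I m f] by (cases "f \<in> S") (auto simp: abs_mult)
    qed
    show "AE f in \<nu>. (\<lambda>m. H f * damping I (1 / Suc m) f) \<longlonglongrightarrow> H f"
    proof (rule AE_I2)
      fix f
      show "(\<lambda>m. H f * damping I (1 / Suc m) f) \<longlonglongrightarrow> H f"
      proof (cases "H f = 0")
        case False
        then have "exceedance_sum I f > 0" using supp exceedance_sum_pos_iff[OF I] by blast
        then obtain m0 where m0: "1 / Suc m0 < exceedance_sum I f" using nat_approx_posE by blast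
        have "\<forall>\<^sub>F m in sequentially. H f * damping I (1 / Suc m) f = H f"
          using eventually_ge_at_top[of m0]
        proof eventually_elim
          case (elim m)
          then have "1 / Suc m \<le> 1 / Suc m0" by (simp add: frac_le)
          then show ?case using m0 damping_eq_1[OF pos, of m I f] by simp
        qed
        then show ?thesis by (rule tendsto_eventually)
      qed simp
    qed
  qed (use H_meas damping_measurable[of I] in \<open>auto simp: measurable_\<nu>\<close>)
qed

text \<open>
  Damping changes the value of \<open>H\<close> only where \<open>H \<noteq> 0\<close>, which forces some supremum above
  \<open>c\<close>, and where \<open>exceedance_sum I\<close> is below \<open>\<eta>\<close>, which forces each of its summands below
  \<open>\<eta>\<close>.
\<close>

lemma expectation_undamped_error:
  fixes H :: "'d \<Rightarrow> real"
  assumes I: "finite I" and \<eta>: "\<eta> > 0" and z: "z > 0"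
    and H: "continuous_on UNIV H" "\<And>f. \<bar>H f\<bar> \<le> C"
    and supp: "\<And>f. H f \<noteq> 0 \<Longrightarrow> \<exists>n\<in>I. nrm_sup nrm Q (KQ n) f > ennreal c"
  shows "\<bar>expectation (\<lambda>\<omega>. H (scaled z \<omega>)) - expectation (\<lambda>\<omega>. H (scaled z \<omega>) * damping I \<eta> (scaled z \<omega>))\<bar> \<le>
    C * (\<Sum>n\<in>I. prob {\<omega>\<in>space M. nrm_sup nrm Q (KQ n) (X \<omega>) > ennreal (c * z) \<and>
      exceedance nrm q (KQ n) (scaled z \<omega>) \<le> ennreal \<eta>})"
proof -
  define A where "A n = {\<omega>\<in>space M. nrm_sup nrm Q (KQ n) (X \<omega>) > ennreal (c * z) \<and>
      exceedance nrm q (KQ n) (scaled z \<omega>) \<le> ennreal \<eta>}" for n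
  have C: "C \<ge> 0" using H(2)[of undefined] by simp
  have cz: "c * z \<ge> 0" using c z by simp
  have H_meas: "H \<in> borel_measurable borel" using H(1) by (rule borel_measurable_continuous_onI)
  have A: "A n \<in> events" for n
  proof -
    have "A n = {\<omega>\<in>space M. nrm_sup nrm Q (KQ n) (X \<omega>) > ennreal (c * z)} \<inter>
        {\<omega>\<in>space M. scaled z \<omega> \<in> {f. E (KQ n) f \<le> \<eta>}}"
      using \<eta> by (auto simp: A_def exceedance_eq ennreal_le_iff)
    moreover have "{f. E (KQ n) f \<le> \<eta>} \<in> sets borel"
      using E_measurable[of "KQ n"] by measurable
    note random_sets[OF scaled_random[OF z] this]
    ultimately show ?thesis
      using nrm_sup_X_sets[OF cz] by (simp only: sets.Int)
  qed
  let ?d = "\<lambda>\<omega>. H (scaled z \<omega>) - H (scaled z \<omega>) * damping I \<eta> (scaled z \<omega>)"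
  have d_le: "\<bar>?d \<omega>\<bar> \<le> C * (\<Sum>n\<in>I. indicator (A n) \<omega>)" if \<omega>: "\<omega> \<in> space M" for \<omega>
  proof (cases "?d \<omega> = 0")
    case True
    then show ?thesis
      using C by (simp only: abs_zero) (intro mult_nonneg_nonneg sum_nonneg, simp_all)
  next
    case False
    then have "H (scaled z \<omega>) \<noteq> 0" and "damping I \<eta> (scaled z \<omega>) \<noteq> 1" by auto
    then obtain n where n: "n \<in> I" "nrm_sup nrm Q (KQ n) (scaled z \<omega>) > ennreal c"
      and "exceedance_sum I (scaled z \<omega>) < \<eta>"
      using supp damping_eq_1[OF \<eta>, of I "scaled z \<omega>"] by (meson not_le)
    then have "E (KQ n) (scaled z \<omega>) \<le> \<eta>"
      using exceedance_sum_ge[OF I, of n "scaled z \<omega>"] by linarith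
    moreover have "nrm_sup nrm Q (KQ n) (X \<omega>) > ennreal (c * z)"
      using n(2) c z less_nrm_sup_iff[of c "KQ n" "scaled z \<omega>"] less_nrm_sup_iff[OF cz, of "KQ n" "X \<omega>"]
      by (auto simp: nrm_scaled field_simps)
    ultimately have "\<omega> \<in> A n"
      using \<omega> by (simp add: A_def exceedance_eq ennreal_leI)
    then have "(1::real) \<le> (\<Sum>n\<in>I. indicator (A n) \<omega>)"
      using member_le_sum[of n I "\<lambda>n. indicator (A n) \<omega> :: real"] n(1) I by simp
    moreover have "\<bar>?d \<omega>\<bar> \<le> C"
    proof -
      have "\<bar>?d \<omega>\<bar> = \<bar>H (scaled z \<omega>)\<bar> * \<bar>1 - damping I \<eta> (scaled z \<omega>)\<bar>"
        by (simp add: abs_mult[symmetric] algebra_simps)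
      also have "\<dots> \<le> C * 1"
        using H(2) damping_bounds[OF \<eta>, of I "scaled z \<omega>"] C by (intro mult_mono) auto
      finally show ?thesis by simp
    qed
    ultimately show ?thesis
      using C mult_left_mono[of 1 "\<Sum>n\<in>I. indicator (A n) \<omega>" C] by linarith
  qed
  have int_H: "integrable M (\<lambda>\<omega>. H (scaled z \<omega>))"
    using measurable_compose[OF scaled_random[OF z] H_meas] H(2)
    by (intro integrable_const_bound[of _ C]) auto
  have int_HD: "integrable M (\<lambda>\<omega>. H (scaled z \<omega>) * damping I \<eta> (scaled z \<omega>))"
  proof (rule Bochner_Integration.integrable_bound[OF int_H])
    show "(\<lambda>\<omega>. H (scaled z \<omega>) * damping I \<eta> (scaled z \<omega>)) \<in> borel_measurable M"
      using measurable_compose[OF scaled_random[OF z] H_meas]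
        measurable_compose[OF scaled_random[OF z] damping_measurable[of I \<eta>]]
      by (rule borel_measurable_times)
    show "AE \<omega> in M. norm (H (scaled z \<omega>) * damping I \<eta> (scaled z \<omega>)) \<le> norm (H (scaled z \<omega>))"
      using damping_bounds[OF \<eta>, of I] by (intro AE_I2) (simp add: abs_mult mult_left_le)
  qed
  have int_A: "integrable M (\<lambda>\<omega>. C * (\<Sum>n\<in>I. indicator (A n) \<omega>))"
    using A by (intro integrable_mult_right Bochner_Integration.integrable_sum) (simp add: less_top[symmetric])
  have "\<bar>expectation ?d\<bar> \<le> expectation (\<lambda>\<omega>. \<bar>?d \<omega>\<bar>)"
    by (rule integral_abs_bound)
  also have "\<dots> \<le> expectation (\<lambda>\<omega>. C * (\<Sum>n\<in>I. indicator (A n) \<omega>))"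
    by (rule integral_mono) (use int_H int_HD int_A d_le in auto)
  also have "\<dots> = C * (\<Sum>n\<in>I. prob (A n))"
    using A by (simp add: Bochner_Integration.integral_sum less_top[symmetric])
  finally show ?thesis
    unfolding Bochner_Integration.integral_diff[OF int_H int_HD] A_def .
qed

text \<open>
  A three-epsilon argument: \<open>\<eta>\<close> is chosen first, so that both the integral of the damped
  function is close to that of \<open>H\<close> and the damping error is eventually small in \<open>z\<close>; then \<open>z\<close>
  tends to infinity.
\<close>

lemma undamped_tendsto:
  fixes H :: "'d \<Rightarrow> real"
  assumes I: "finite I"
    and H: "continuous_on UNIV H" "\<And>f. \<bar>H f\<bar> \<le> C"
    and supp: "\<And>f. H f \<noteq> 0 \<Longrightarrow> \<exists>n\<in>I. nrm_sup nrm Q (KQ n) f > ennreal c"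
  shows "((\<lambda>z. scaling z * expectation (\<lambda>\<omega>. H (scaled z \<omega>))) \<longlongrightarrow> integral\<^sup>L \<nu> H) at_top"
proof (rule tendstoI)
  fix e :: real assume e: "e > 0"
  have C: "C \<ge> 0" using H(2)[of undefined] by simp
  have supp1: "\<exists>n\<in>I. nrm_sup nrm Q (KQ n) f > 1" if "H f \<noteq> 0" for f
  proof -
    have "1 < ennreal c" using c by simp
    then show ?thesis using supp[OF that] by (meson less_trans)
  qed
  define r where "r \<eta> z n = prob {\<omega>\<in>space M. nrm_sup nrm Q (KQ n) (X \<omega>) > ennreal (c * z) \<and>
      exceedance nrm q (KQ n) (scaled z \<omega>) \<le> ennreal \<eta>} / tail t0 z" for \<eta> z n
  \<comment> \<open>The summand \<open>1\<close> keeps the denominator positive when \<open>C = 0\<close> or \<open>I\<close> is empty.\<close>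
  define N where "N = C * p t0 * card I + 1"
  define d where "d = e / (3 * N)"
  have N: "N > 0" unfolding N_def using C p_t0 by (intro add_nonneg_pos) auto
  have d: "d > 0" using e N by (simp add: d_def)
  have d_le: "C * p t0 * card I * d < e / 3"
  proof -
    have "C * p t0 * card I * d < N * d" using d by (simp add: N_def algebra_simps)
    also have "\<dots> = e / 3" using N by (simp add: d_def)
    finally show ?thesis .
  qed
  have eta_seq: "filterlim (\<lambda>m. 1 / real (Suc m)) (at_right 0) sequentially"
    using LIMSEQ_inverse_real_of_nat unfolding inverse_eq_divide
    by (rule filterlim_at_withinI) (auto intro!: always_eventually)
  have small: "\<forall>\<^sub>F m in sequentially. \<forall>\<^sub>F z in at_top. r (1 / Suc m) z n < d" for n
  proof -
    have "((\<lambda>\<eta>. Limsup at_top (\<lambda>z. ereal (r \<eta> z n))) \<longlongrightarrow> 0) (at_right 0)"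
      using exceedance_negligible[of 1 "KQ n"] by (simp add: r_def tail_def scaled_def)
    then have "\<forall>\<^sub>F \<eta> in at_right 0. Limsup at_top (\<lambda>z. ereal (r \<eta> z n)) < ereal d"
      using d by (intro order_tendstoD(2)) auto
    then have "\<forall>\<^sub>F \<eta> in at_right 0. \<forall>\<^sub>F z in at_top. r \<eta> z n < d"
      by (rule eventually_mono) (drule Limsup_lessD, simp only: less_ereal.simps)
    from eventually_compose_filterlim[OF this eta_seq] show ?thesis .
  qed
  have "\<forall>\<^sub>F m in sequentially. \<forall>n\<in>I. \<forall>\<^sub>F z in at_top. r (1 / Suc m) z n < d"
    using small I by (intro eventually_ball_finite) auto
  moreover have "\<forall>\<^sub>F m in sequentially. dist (LINT f|\<nu>. H f * damping I (1 / Suc m) f) (integral\<^sup>L \<nu> H) < e / 3"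
    by (rule tendstoD[OF damping_integral_tendsto[where C=C and H=H]]) (fact I H supp1 | use e in simp)+
  ultimately have "\<forall>\<^sub>F m in sequentially. (\<forall>n\<in>I. \<forall>\<^sub>F z in at_top. r (1 / Suc m) z n < d) \<and>
      dist (LINT f|\<nu>. H f * damping I (1 / Suc m) f) (integral\<^sup>L \<nu> H) < e / 3"
    by (rule eventually_conj)
  then obtain m where m: "\<forall>n\<in>I. \<forall>\<^sub>F z in at_top. r (1 / Suc m) z n < d"
    "dist (LINT f|\<nu>. H f * damping I (1 / Suc m) f) (integral\<^sup>L \<nu> H) < e / 3"
    using eventually_happens'[OF sequentially_bot] by blast
  define \<eta> :: real where "\<eta> = 1 / Suc m"
  have \<eta>: "\<eta> > 0" by (simp add: \<eta>_def)
  have "\<forall>\<^sub>F z in at_top. \<forall>n\<in>I. r \<eta> z n < d"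
    using m(1) I by (intro eventually_ball_finite) (auto simp: \<eta>_def)
  moreover have "\<forall>\<^sub>F z in at_top. dist (scaling z * expectation (\<lambda>\<omega>. H (scaled z \<omega>) * damping I \<eta> (scaled z \<omega>)))
      (LINT f|\<nu>. H f * damping I \<eta> f) < e / 3"
    by (rule tendstoD[OF damped_tendsto(2)[where C=C and H=H]]) (fact I \<eta> H | use e in simp)+
  ultimately show "\<forall>\<^sub>F z in at_top. dist (scaling z * expectation (\<lambda>\<omega>. H (scaled z \<omega>))) (integral\<^sup>L \<nu> H) < e"
    using eventually_gt_at_top[of 0]
  proof eventually_elim
    case (elim z)
    let ?a = "expectation (\<lambda>\<omega>. H (scaled z \<omega>))"
    let ?b = "expectation (\<lambda>\<omega>. H (scaled z \<omega>) * damping I \<eta> (scaled z \<omega>))"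
    have "scaling z * \<bar>?a - ?b\<bar> \<le> scaling z * (C * (\<Sum>n\<in>I. prob {\<omega>\<in>space M.
        nrm_sup nrm Q (KQ n) (X \<omega>) > ennreal (c * z) \<and> exceedance nrm q (KQ n) (scaled z \<omega>) \<le> ennreal \<eta>}))"
      by (rule mult_left_mono[OF expectation_undamped_error[where C=C and H=H] scaling_nonneg])
        (fact I \<eta> elim(3) H supp)+
    also have "\<dots> = C * p t0 * (\<Sum>n\<in>I. r \<eta> z n)"
      unfolding r_def sum_divide_distrib[symmetric] scaling_def by simp
    also have "\<dots> \<le> C * p t0 * (\<Sum>n\<in>I. d)"
      using elim(1) C p_t0 by (intro mult_left_mono sum_mono) (auto intro: less_imp_le)
    also have "\<dots> = C * p t0 * card I * d" by simp
    also have "\<dots> < e / 3" by (rule d_le)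
    finally have "\<bar>scaling z * ?a - scaling z * ?b\<bar> < e / 3"
      unfolding right_diff_distrib[symmetric] abs_mult abs_of_nonneg[OF scaling_nonneg] .
    then show ?case
      using elim(2) m(2) unfolding dist_real_def \<eta>_def[symmetric] by linarith
  qed
qed

section \<open>Rescaling the threshold\<close>

lemma integral_act:
  fixes H :: "'d \<Rightarrow> real"
  assumes e: "e > 0" and H: "H \<in> borel_measurable borel"
  shows "(LINT f|\<nu>. H (act e f)) = e powr \<alpha> * integral\<^sup>L \<nu> H"
proof -
  have act: "act e \<in> \<nu> \<rightarrow>\<^sub>M borel" using act_measurable_fixed[OF e] by (simp add: measurable_\<nu>)
  have "distr \<nu> borel (act e) = scale_measure (ennreal (e powr \<alpha>)) \<nu>"
  proof (rule measure_eqI)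
    fix A assume "A \<in> sets (distr \<nu> borel (act e))"
    then have A: "A \<in> sets borel" by simp
    have "act e -` A = act (1 / e) ` A"
      using vimage_act_eq_image[of "1 / e" A] e by simp
    then show "emeasure (distr \<nu> borel (act e)) A = emeasure (scale_measure (ennreal (e powr \<alpha>)) \<nu>) A"
      using \<nu>_homogeneous[of "1 / e" A] A act e by (simp add: emeasure_distr powr_divide powr_minus)
  qed (simp add: sets_\<nu>)
  then have "integral\<^sup>L (distr \<nu> borel (act e)) H = e powr \<alpha> * integral\<^sup>L \<nu> H"
    using H by (simp add: integral_scale_measure measurable_\<nu>)
  then show ?thesis using act H by (simp add: integral_distr)
qed

text \<open>
  Passing from \<open>H\<close> to \<open>H \<circ> act (e / c)\<close> moves the threshold from \<open>e\<close> to \<open>c\<close> and replaces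
  \<open>z\<close> by \<open>z * (e / c)\<close>. The quotient of the two scaling functions tends to
  \<open>(e / c) powr - \<alpha>\<close>, the inverse of the factor by which the integral changes.
\<close>

lemma scaled_law_integral_tendsto:
  fixes H :: "'d \<Rightarrow> real"
  assumes I: "finite I" and e: "e > 0"
    and H: "continuous_on UNIV H" "\<And>f. \<bar>H f\<bar> \<le> C"
    and supp: "\<And>f. H f \<noteq> 0 \<Longrightarrow> \<exists>n\<in>I. nrm_sup nrm Q (KQ n) f > ennreal e"
  shows "((\<lambda>z. integral\<^sup>L (scaled_law act M X (scaling z) z) H) \<longlongrightarrow> integral\<^sup>L \<nu> H) at_top"
proof -
  \<comment> \<open>With this choice \<open>nrm t (act s f) > e\<close> holds exactly if \<open>nrm t f > c\<close>.\<close>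
  define s where "s = e / c"
  have s: "s > 0" using e c by (simp add: s_def)
  define H' where "H' f = H (act s f)" for f
  define a where "a z = scaling z * expectation (\<lambda>\<omega>. H' (scaled z \<omega>))" for z
  have H_meas: "H \<in> borel_measurable borel" using H(1) by (rule borel_measurable_continuous_onI)
  have "(a \<longlongrightarrow> integral\<^sup>L \<nu> H') at_top"
    unfolding a_def[abs_def]
  proof (rule undamped_tendsto[OF I])
    show "continuous_on UNIV H'"
      unfolding H'_def[abs_def] using continuous_on_compose2[OF H(1) act_continuous[OF s]] by simp
    fix f assume "H' f \<noteq> 0"
    then obtain n where "n \<in> I" "nrm_sup nrm Q (KQ n) (act s f) > ennreal e"
      using supp by (auto simp: H'_def)
    then show "\<exists>n\<in>I. nrm_sup nrm Q (KQ n) f > ennreal c"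
      using e c s less_nrm_sup_iff[of e "KQ n" "act s f"] less_nrm_sup_iff[of c "KQ n" f]
      by (force simp: nrm_homogeneous s_def field_simps)
  qed (use H(2) in \<open>simp add: H'_def\<close>)
  moreover have "filterlim (\<lambda>z. z * s) at_top at_top"
    using s by (intro filterlim_at_top_mult_tendsto_pos[OF tendsto_const _ filterlim_ident])
  ultimately have "((\<lambda>z. a (z * s)) \<longlongrightarrow> integral\<^sup>L \<nu> H') at_top"
    by (rule filterlim_compose)
  from tendsto_mult[OF X_t0_regularly_varying[OF s] this]
  have "((\<lambda>z. tail t0 (z * s) / tail t0 z * a (z * s)) \<longlongrightarrow> s powr - \<alpha> * integral\<^sup>L \<nu> H') at_top"
    unfolding tail_def .
  moreover have "s powr - \<alpha> * integral\<^sup>L \<nu> H' = integral\<^sup>L \<nu> H"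
    unfolding H'_def[abs_def] integral_act[OF s H_meas] using s
    by (simp add: mult.assoc[symmetric] powr_add[symmetric])
  moreover have "\<forall>\<^sub>F z in at_top. tail t0 (z * s) / tail t0 z * a (z * s) =
      integral\<^sup>L (scaled_law act M X (scaling z) z) H"
    using eventually_gt_at_top[of 0]
  proof eventually_elim
    case (elim z)
    have "H' (scaled (z * s) \<omega>) = H (scaled z \<omega>)" for \<omega>
      using s elim by (simp add: H'_def scaled_def act_act)
    then have "tail t0 (z * s) / tail t0 z * a (z * s) = scaling z * expectation (\<lambda>\<omega>. H (scaled z \<omega>))"
      using tail_t0_pos[of "z * s"] by (simp add: a_def scaling_def)
    also have "\<dots> = integral\<^sup>L (scaled_law act M X (scaling z) z) H"
      unfolding scaled_law_def using scaled_random[OF elim] H_meas scaling_nonneg[of z]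
      by (simp add: integral_scale_measure integral_distr scaled_def[abs_def])
    finally show ?case .
  qed
  ultimately show ?thesis by (simp only:) (rule Lim_transform_eventually)
qed

lemma emeasure_nrm_sup_finite_level:
  assumes e: "e > 0"
  shows "emeasure \<nu> {f. nrm_sup nrm Q (KQ n) f > ennreal e} < \<infinity>"
proof -
  have "act (1 / e) f \<in> {f. nrm_sup nrm Q (KQ n) f > 1} \<longleftrightarrow> nrm_sup nrm Q (KQ n) f > ennreal e" for f
    using e less_nrm_sup_iff[of 1 "KQ n" "act (1 / e) f"] less_nrm_sup_iff[of e "KQ n" f]
    by (force simp: nrm_homogeneous field_simps)
  then have "{f. nrm_sup nrm Q (KQ n) f > ennreal e} = act e ` {f. nrm_sup nrm Q (KQ n) f > 1}"
    using act_image_iff[OF e, of _ "{f. nrm_sup nrm Q (KQ n) f > 1}"] by blast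
  then show ?thesis
    using \<nu>_homogeneous[OF e, of "{f. nrm_sup nrm Q (KQ n) f > 1}"] nrm_sup_sets[of 1 "KQ n"]
      emeasure_nrm_sup_finite[of n]
    by (simp add: ennreal_mult_less_top)
qed

end

section \<open>Regular variation\<close>

theorem theorem4p7:
  fixes act :: "real \<Rightarrow> 'd::polish_space \<Rightarrow> 'd"
    and nrm :: "'t \<Rightarrow> 'd \<Rightarrow> real"
    and T Q :: "'t set"
    and KQ :: "nat \<Rightarrow> 't set"
    and B :: "'d set set"
    and M :: "'w measure"
    and X :: "'w \<Rightarrow> 'd"
    and Y :: "'t \<Rightarrow> 'w \<Rightarrow> 'd"
    and t0 :: 't
    and \<alpha> c :: real
    and p q :: "'t \<Rightarrow> real"
  assumes setting: "homogeneous_setting act nrm T Q KQ"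
    and act_continuous: "\<And>z. z > 0 \<Longrightarrow> continuous_on UNIV (act z)"
    and prob: "prob_space M" and complete: "complete_measure M"
    and boundedness: "properly_localised_boundedness B"
    and boundedness_act: "\<And>A z. A \<in> B \<Longrightarrow> z > 0 \<Longrightarrow> act z ` A \<in> B"
    and X_random: "X \<in> M \<rightarrow>\<^sub>M borel"
    and t0: "t0 \<in> Q" and \<alpha>: "\<alpha> > 0"
    and X_t0_regularly_varying: "\<And>t. t > 0 \<Longrightarrow>
      ((\<lambda>z. measure M {\<omega>\<in>space M. nrm t0 (X \<omega>) > z * t} /
             measure M {\<omega>\<in>space M. nrm t0 (X \<omega>) > z}) \<longlongrightarrow> t powr (-\<alpha>)) at_top"
    and p_nonneg: "\<And>h. h \<in> Q \<Longrightarrow> p h \<ge> 0" and p_t0: "p t0 > 0"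
    and tail_ratio: "\<And>h. h \<in> Q \<Longrightarrow>
      ((\<lambda>z. measure M {\<omega>\<in>space M. nrm h (X \<omega>) > z} /
             measure M {\<omega>\<in>space M. nrm t0 (X \<omega>) > z}) \<longlongrightarrow> p h / p t0) at_top"
    and conditional_limit: "\<And>h. h \<in> Q \<Longrightarrow> p h > 0 \<Longrightarrow>
      weakly_converges (conditional_scaled_law act nrm M X h) (distr M borel (Y h)) at_top"
    and limsup_finite: "\<And>\<epsilon> K. \<epsilon> > 0 \<Longrightarrow> K \<in> range KQ \<Longrightarrow>
      Limsup at_top (\<lambda>z. ereal
        (measure M {\<omega>\<in>space M. nrm_sup nrm Q K (X \<omega>) > ennreal (\<epsilon> * z)} /
         measure M {\<omega>\<in>space M. nrm t0 (X \<omega>) > z})) < \<infinity>"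
    and c: "c > 1"
    and q_pos: "\<And>t. t \<in> Q \<Longrightarrow> q t > 0"
    and q_summable: "(\<lambda>t. max 1 (p t) * q t) summable_on Q"
    and exceedance_negligible: "\<And>\<epsilon> K. \<epsilon> > 0 \<Longrightarrow> K \<in> range KQ \<Longrightarrow>
      ((\<lambda>\<eta>. Limsup at_top (\<lambda>z. ereal
        (measure M {\<omega>\<in>space M. nrm_sup nrm Q K (X \<omega>) > ennreal (c * \<epsilon> * z) \<and>
                                 exceedance nrm q K (act (1 / (\<epsilon> * z)) (X \<omega>)) \<le> ennreal \<eta>} /
         measure M {\<omega>\<in>space M. nrm t0 (X \<omega>) > z}))) \<longlongrightarrow> 0) (at_right 0)"
    and tail_processes: "tail_process_family act nrm Q \<alpha> p M Y"
    and exceedance_continuous: "\<And>h K. h \<in> Q \<Longrightarrow> K \<in> range KQ \<Longrightarrow>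
      AE f in distr M borel (Y h). isCont (exceedance nrm q K) f"
    and boundedness_iff: "\<And>A. A \<in> B \<longleftrightarrow>
      (\<exists>K_A \<epsilon>_A. K_A \<subseteq> T \<and> (\<exists>I. finite I \<and> K_A \<inter> Q \<subseteq> (\<Union>n\<in>I. KQ n)) \<and>
                  \<epsilon>_A > (0::real) \<and> (\<forall>f\<in>A. nrm_sup nrm Q K_A f > ennreal \<epsilon>_A))"
  shows "\<exists>\<nu>. boundedly_finite B \<nu> \<and> tail_measure act nrm Q \<alpha> \<nu> \<and>
    (\<forall>K\<in>range KQ. emeasure \<nu> {f. nrm_sup nrm Q K f > 1} < \<infinity>) \<and>
    regularly_varying act B M X \<nu>
      (\<lambda>z. p t0 / measure M {\<omega>\<in>space M. nrm t0 (X \<omega>) > z})"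
proof -
  obtain \<nu> where \<nu>: "sets \<nu> = sets borel"
    "\<And>h r A. h \<in> Q \<Longrightarrow> r > 0 \<Longrightarrow> A \<in> sets borel \<Longrightarrow> A \<subseteq> {f. nrm h f > r} \<Longrightarrow>
      emeasure \<nu> A = ennreal (p h * r powr - \<alpha>) * emeasure M {\<omega>\<in>space M. act r (Y h \<omega>) \<in> A}"
    "\<And>z A. z > 0 \<Longrightarrow> A \<in> sets borel \<Longrightarrow>
      emeasure \<nu> (act z ` A) = ennreal (z powr - \<alpha>) * emeasure \<nu> A"
    "\<And>A. A \<in> sets borel \<Longrightarrow> (\<And>h f. h \<in> Q \<Longrightarrow> f \<in> A \<Longrightarrow> nrm h f = 0) \<Longrightarrow> emeasure \<nu> A = 0"
  proof (rule homogeneous_setting.tail_measure_of_family[OF setting tail_processes prob], goal_cases)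
    case (1 \<nu>)
    from 1(2-5) show ?case by (rule 1(1))
  qed
  have Y: "\<And>h. h \<in> Q \<Longrightarrow> Y h \<in> M \<rightarrow>\<^sub>M borel"
    "\<And>h. h \<in> Q \<Longrightarrow> measure M {\<omega>\<in>space M. nrm h (Y h \<omega>) > 1} = 1"
    using tail_processes unfolding tail_process_family_def by blast+
  interpret regularly_varying_setting act nrm T Q KQ M X Y t0 \<alpha> c p q \<nu>
    by (intro regularly_varying_setting.intro regularly_varying_setting_axioms.intro)
      (fact setting prob act_continuous X_random Y t0 X_t0_regularly_varying p_nonneg p_t0 tail_ratio
        conditional_limit limsup_finite c q_pos q_summable exceedance_negligible exceedance_continuous \<nu>)+
  \<comment> \<open>One of the finitely many \<open>KQ n\<close> that cover the index set carries the exceedance.\<close>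
  have covered: "\<exists>e>0. \<exists>I. finite I \<and> (\<forall>f\<in>A. \<exists>n\<in>I. nrm_sup nrm Q (KQ n) f > ennreal e)"
    if A: "A \<in> B" for A
  proof -
    obtain K e I where K: "finite I" "K \<inter> Q \<subseteq> (\<Union>n\<in>I. KQ n)" "e > (0::real)"
      "\<And>f. f \<in> A \<Longrightarrow> nrm_sup nrm Q K f > ennreal e"
      using boundedness_iff[THEN iffD1, OF A] by blast
    have "\<exists>n\<in>I. nrm_sup nrm Q (KQ n) f > ennreal e" if f: "f \<in> A" for f
    proof -
      obtain t where t: "t \<in> Q" "e < nrm t f" and "t \<in> K \<inter> Q"
        using K(3) K(4)[OF f] less_nrm_sup_iff[of e K f] by auto
      then obtain n where n: "n \<in> I" "t \<in> KQ n" using K(2) by blast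
      have "nrm_sup nrm Q (KQ n) f > ennreal e"
        using t n(2) K(3) less_nrm_sup_iff[of e "KQ n" f] by auto
      then show ?thesis using n(1) by blast
    qed
    then show ?thesis using K(1,3) by blast
  qed
  have finite_\<nu>: "boundedly_finite B \<nu>"
    unfolding boundedly_finite_def
  proof (intro conjI ballI impI)
    fix A assume "A \<in> sets borel" and "A \<in> B"
    then obtain e I where I: "e > 0" "finite I" "\<forall>f\<in>A. \<exists>n\<in>I. nrm_sup nrm Q (KQ n) f > ennreal e"
      using covered by blast
    let ?S = "\<lambda>n. {f. nrm_sup nrm Q (KQ n) f > ennreal e}"
    have S: "?S n \<in> sets \<nu>" for n using nrm_sup_sets[of e "KQ n"] I(1) by (simp add: sets_\<nu>)
    have "emeasure \<nu> A \<le> emeasure \<nu> (\<Union>n\<in>I. ?S n)"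
      using I S by (intro emeasure_mono) auto
    also have "\<dots> \<le> (\<Sum>n\<in>I. emeasure \<nu> (?S n))"
      using I(2) S by (intro emeasure_subadditive_finite) auto
    also have "\<dots> < \<infinity>"
      using emeasure_nrm_sup_finite_level[OF I(1)] I(2) by (simp add: less_top[symmetric])
    finally show "emeasure \<nu> A < \<infinity>" .
  qed (rule sets_\<nu>)
  \<comment> \<open>The sets in \<open>B\<close> cover the space, so no point has all its norms equal to \<open>0\<close>.\<close>
  have "\<exists>h\<in>Q. nrm h f > 0" for f
  proof -
    obtain A where "A \<in> B" "f \<in> A"
      using boundedness unfolding properly_localised_boundedness_def by (metis UN_E UNIV_I)
    then obtain e n where "e > 0" "nrm_sup nrm Q (KQ n) f > ennreal e" using covered by meson
    then show ?thesis using less_nrm_sup_iff[of e "KQ n" f] by force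
  qed
  then have "nrm_sup nrm Q Q f \<noteq> 0" for f
    using less_nrm_sup_iff[of 0 Q f] by fastforce
  then have tail: "tail_measure act nrm Q \<alpha> \<nu>"
    unfolding tail_measure_def using \<alpha> sets_\<nu> \<nu>_homogeneous emeasure_level t0 p_t0 by auto
  have "vaguely_converges B (\<lambda>z. scaled_law act M X (scaling z) z) \<nu> at_top"
    unfolding vaguely_converges_def
  proof (intro conjI allI impI finite_\<nu>)
    show "\<forall>\<^sub>F z in at_top. boundedly_finite B (scaled_law act M X (scaling z) z)"
      using eventually_gt_at_top[of 0]
    proof eventually_elim
      case (elim z)
      show ?case
        unfolding boundedly_finite_def
      proof (intro conjI ballI impI)
        fix A :: "'d set" assume "A \<in> sets borel"
        then have "emeasure (scaled_law act M X (scaling z) z) A =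
            ennreal (scaling z) * emeasure M {\<omega>\<in>space M. X \<omega> \<in> act z ` A}"
          by (rule emeasure_scaled_law[OF X_random elim])
        then show "emeasure (scaled_law act M X (scaling z) z) A < \<infinity>"
          by (simp add: emeasure_eq_measure ennreal_mult_less_top)
      qed (simp add: scaled_law_def)
    qed
    fix H :: "'d \<Rightarrow> real"
    assume H: "continuous_on UNIV H" "bounded (range H)" "closure {f. H f \<noteq> 0} \<in> B"
    obtain C where C: "\<And>f. \<bar>H f\<bar> \<le> C" using H(2) by (auto simp: bounded_iff)
    obtain e I where "e > 0" "finite I"
      and supp: "\<forall>f\<in>closure {f. H f \<noteq> 0}. \<exists>n\<in>I. nrm_sup nrm Q (KQ n) f > ennreal e"
      using covered[OF H(3)] by blast
    then show "((\<lambda>z. integral\<^sup>L (scaled_law act M X (scaling z) z) H) \<longlongrightarrow> integral\<^sup>L \<nu> H) at_top"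
      using closure_subset[of "{f. H f \<noteq> 0}"]
      by (intro scaled_law_integral_tendsto[of I e H C] H(1) C) auto
  qed
  then have "regularly_varying act B M X \<nu> (\<lambda>z. p t0 / measure M {\<omega>\<in>space M. nrm t0 (X \<omega>) > z})"
    unfolding regularly_varying_def scaling_def tail_def .
  then show ?thesis
    using finite_\<nu> tail emeasure_nrm_sup_finite by blast
qed

thm_deps theorem4p7

end
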